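(* Let $R,Q$ be probability distributions on $\mathbb{R}$ with $Q\ll R$ and $\frac{dQ}{dR}(x)<\infty$ for all $x\in\mathbb{R}$, let $c\in(0,1)$ be fixed and $\tau_n=\lfloor cn\rfloor$. Let $\{X_{n,j}\}_{n\in\mathbb{N},1\le j\le n}$ be a triangular array such that for every $n$, $X_{n,1},\dots,X_{n,\tau_n}$ are i.i.d. from $R$, $X_{n,\tau_n+1},\dots,X_{n,n}$ are i.i.d. from $Q$, and $(X_{n,1},\dots,X_{n,\tau_n})$ is independent of $(X_{n,\tau_n+1},\dots,X_{n,n})$. Assume: (i) for all $\delta\in(0,1)$, the $\delta$-th quantile of the mixture distribution $cR+(1-c)Q$ is unique; (ii) $R,Q$ are absolutely continuous with respect to Lebesgue measure with continuous densities $r,q$, and $\mathbb{E}_{Z\sim Q}\left[\left(\frac{dQ}{dR}(Z)\right)^2\right]<\infty$ and $\mathbb{E}_{Z\sim R}\left[\left(\frac{dQ}{dR}(Z)\right)^2\right]<\infty$. Let $\lambda_1,\lambda_2,\dots$ be i.i.d. $U(0,1)$, with $\{\lambda_n\}_{n\in\mathbb{N}}$ independent of the array, and define $$p_n:=\frac{\sum_{i=1}^n \mathbf{1}(X_{n,i}<X_{n,n})+\lambda_n\sum_{i=1}^n\mathbf{1}(X_{n,i}=X_{n,n})}{n}.$$ Let $F_{p_n}$ be the conditional CDF of $p_n$ given the unordered collection (multiset) $\{X_{n,i}\}_{i=1}^n$, equivalently given the order statistics of the $n$-th row. Then $$\sup_{\epsilon\in\mathbb{R}}\left|F_{p_n}(\epsilon)-F_{p_{n+1}}(\epsilon)\right|=O_p\left(\frac{1}{\sqrt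 n}\right).$$
   Context: $Q\ll R$ means absolute continuity and $\frac{dQ}{dR}$ is the Radon–Nikodym derivative. $O_p(1/\sqrt n)$ means that $\sqrt n$ times the left-hand side is stochastically bounded (tight) as $n\to\infty$. All rows of the array and the variables $\lambda_n$ live on a common probability space. *)

theory Defs
  imports "HOL-Probability.Probability"
begin

definition mixture :: "real \<Rightarrow> real measure \<Rightarrow> real measure \<Rightarrow> real measure" where
  "mixture c R Q =
     measure_of (space R) (sets R)
       (\<lambda>A. ennreal c * emeasure R A + ennreal (1 - c) * emeasure Q A)"

lemma space_mixture [simp]: "space (mixture c R Q) = space R"
  by (simp add: mixture_def)

lemma sets_mixture [simp]: "sets (mixture c R Q) = sets R"
  by (simp add: mixture_def)

lemma emeasure_mixture:
  assumes "sets Q = sets R" "A \<in> sets R"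
  shows "emeasure (mixture c R Q) A = ennreal c * emeasure R A + ennreal (1 - c) * emeasure Q A"
  unfolding mixture_def
proof (rule emeasure_measure_of_sigma)
  show "sigma_algebra (space R) (sets R)" ..
  show "positive (sets R) (\<lambda>A. ennreal c * emeasure R A + ennreal (1 - c) * emeasure Q A)"
    by (simp add: positive_def)
  show "countably_additive (sets R) (\<lambda>A. ennreal c * emeasure R A + ennreal (1 - c) * emeasure Q A)"
  proof (rule countably_additiveI)
    fix B :: "nat \<Rightarrow> real set"
    assume B: "range B \<subseteq> sets R" "disjoint_family B" "(\<Union>i. B i) \<in> sets R"
    then have "range B \<subseteq> sets Q" using assms(1) by simp
    with B show "(\<Sum>i. ennreal c * emeasure R (B i) + ennreal (1 - c) * emeasure Q (B i)) =
        ennreal c * emeasure R (\<Union>i. B i) + ennreal (1 - c) * emeasure Q (\<Union>i. B i)"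
      by (simp add: suminf_add[symmetric] ennreal_suminf_cmult suminf_emeasure)
  qed
qed (fact assms(2))

text \<open>Quantiles in the set-valued sense: there may be a whole interval of them when the
  distribution function is flat, so that uniqueness is a genuine condition.\<close>

definition is_quantile :: "real measure \<Rightarrow> real \<Rightarrow> real \<Rightarrow> bool" where
  "is_quantile D \<delta> x \<longleftrightarrow> \<delta> \<le> measure D {..x} \<and> 1 - \<delta> \<le> measure D {x..}"

definition iid :: "'a measure \<Rightarrow> real measure \<Rightarrow> (nat \<Rightarrow> 'a \<Rightarrow> real) \<Rightarrow> nat set \<Rightarrow> bool" where
  "iid M D Y I \<longleftrightarrow>
     prob_space.indep_vars M (\<lambda>_. borel) Y I \<and> (\<forall>i\<in>I. distr M borel (Y i) = D)"

text \<open>Independence of two random elements whose value types may differ (the library's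
  \<^const>\<open>prob_space.indep_var\<close> forces both value types to coincide).\<close>

definition indep_pair ::
    "'a measure \<Rightarrow> 'b measure \<Rightarrow> ('a \<Rightarrow> 'b) \<Rightarrow> 'c measure \<Rightarrow> ('a \<Rightarrow> 'c) \<Rightarrow> bool" where
  "indep_pair M N Y N' Y' \<longleftrightarrow>
     Y \<in> measurable M N \<and> Y' \<in> measurable M N' \<and>
     prob_space.indep_set M
       {Y -` A \<inter> space M | A. A \<in> sets N} {Y' -` A \<inter> space M | A. A \<in> sets N'}"

definition tau :: "real \<Rightarrow> nat \<Rightarrow> nat" where
  "tau c n = nat \<lfloor>c * real n\<rfloor>"

definition pval :: "(nat \<Rightarrow> nat \<Rightarrow> 'a \<Rightarrow> real) \<Rightarrow> (nat \<Rightarrow> 'a \<Rightarrow> real) \<Rightarrow> nat \<Rightarrow> 'a \<Rightarrow> real" where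
  "pval X lam n \<omega> =
     ((\<Sum>i=1..n. of_bool (X n i \<omega> < X n n \<omega>))
        + lam n \<omega> * (\<Sum>i=1..n. of_bool (X n i \<omega> = X n n \<omega>))) / real n"

definition order_stat :: "nat \<Rightarrow> (nat \<Rightarrow> real) \<Rightarrow> nat \<Rightarrow> real" where
  "order_stat n x k = sort (map x [1..<Suc n]) ! (k - 1)"

text \<open>The sub-sigma-algebra generated by the unordered collection (multiset) of the entries
  of row \<open>n\<close>, i.e. by its order statistics.\<close>

definition row_algebra :: "'a measure \<Rightarrow> (nat \<Rightarrow> nat \<Rightarrow> 'a \<Rightarrow> real) \<Rightarrow> nat \<Rightarrow> 'a measure" where
  "row_algebra M X n =
     vimage_algebra (space M)
       (\<lambda>\<omega>. \<lambda>k\<in>{1..n}. order_stat n (\<lambda>i. X n i \<omega>) k) (PiM {1..n} (\<lambda>_. borel))"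

definition regular_cond_distr ::
    "'a measure \<Rightarrow> 'a measure \<Rightarrow> ('a \<Rightarrow> real) \<Rightarrow> ('a \<Rightarrow> real measure) \<Rightarrow> bool" where
  "regular_cond_distr M G Y K \<longleftrightarrow>
     K \<in> measurable G (prob_algebra borel) \<and>
     (\<forall>A\<in>sets borel. AE \<omega> in M.
        measure (K \<omega>) A = real_cond_exp M G (\<lambda>\<omega>'. indicator A (Y \<omega>')) \<omega>)"

text \<open>\<open>F \<omega> \<epsilon>\<close> is the conditional CDF of \<open>Y\<close> given \<open>G\<close>. It is taken from a regular conditional
  distribution, so that it is a genuine CDF in \<open>\<epsilon>\<close> and suprema over all real \<open>\<epsilon>\<close> are
  determined almost surely (which fails for versions chosen separately for each \<open>\<epsilon>\<close>).\<close>

definition is_cond_cdf ::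
    "'a measure \<Rightarrow> 'a measure \<Rightarrow> ('a \<Rightarrow> real) \<Rightarrow> ('a \<Rightarrow> real \<Rightarrow> real) \<Rightarrow> bool" where
  "is_cond_cdf M G Y F \<longleftrightarrow>
     (\<exists>K. regular_cond_distr M G Y K \<and> (\<forall>\<omega>\<in>space M. \<forall>\<epsilon>. F \<omega> \<epsilon> = cdf (K \<omega>) \<epsilon>))"

text \<open>\<open>Z n = O\<^sub>p(a n)\<close>: the laws of \<open>Z n / a n\<close> are tight. The predicate \<^const>\<open>tight\<close>
  also requires these laws to be probability distributions on the line. An index \<open>n\<close> with
  \<open>a n = 0\<close> contributes the point mass at 0, since \<open>x / 0 = 0\<close>.\<close>

definition bigO_p :: "'a measure \<Rightarrow> (nat \<Rightarrow> 'a \<Rightarrow> real) \<Rightarrow> (nat \<Rightarrow> real) \<Rightarrow> bool" where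
  "bigO_p M Z a \<longleftrightarrow> tight (\<lambda>n. distr M borel (\<lambda>\<omega>. Z n \<omega> / a n))"

end

theory Submission
  imports Defs
begin

text \<open>
  Let \<open>F\<close> be the distribution function of the mixture and \<open>H\<^sub>Q u = Q {x. F x \<le> u}\<close>. Since
  \<open>(1 - c) Q\<close> is dominated by the mixture, \<open>H\<^sub>Q\<close> is Lipschitz. Both conditional CDFs are within
  \<open>O\<^sub>p(1/sqrt n)\<close> of this deterministic function, uniformly in \<open>\<epsilon>\<close>, however consecutive
  rows are coupled.

  Up to the tie-breaking variable, the event \<open>p\<^sub>n \<le> \<epsilon>\<close> says that the rank of the last entry is at most
  \<open>n \<epsilon>\<close>. Given the unordered row, the last entry is exchangeable with the other entries drawn from
  \<open>Q\<close>, so the conditional probability of this event is the conditional expectation of the fraction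
  of entries of the \<open>Q\<close> block with rank at most \<open>n \<epsilon>\<close>. Outside the conditional expectation, this
  fraction differs from \<open>H\<^sub>Q \<epsilon>\<close>, for all \<open>\<epsilon>\<close> at once, by at most \<open>W / sqrt n\<close>, where \<open>W\<close> is built from
  the suprema of the two empirical processes of the blocks and has bounded mean. Conditioning
  preserves the bound and the mean, and Markov's inequality gives tightness.
\<close>

section \<open>A uniform bound for the empirical process\<close>

context prob_space
begin

text \<open>Induction on \<open>I\<close>. In the expansion of \<open>(S + Y i) ^ 4\<close>, with
  \<open>Y i\<close> independent of the partial sum \<open>S\<close>, every product with a factor
  \<open>S ^ 1\<close> or \<open>Y i ^ 1\<close> has mean zero, so the only mixed term left is
  \<open>6 * (S\<^sup>2 * (Y i)\<^sup>2)\<close>. Its mean calls for the second-moment bound, hence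
  the joint statement. The fourth moment of \<open>Y i\<close> is at most \<open>p\<close> because
  \<open>Y i\<close> is bounded by 1.\<close>

lemma expectation_sum_square_pow4_le:
  fixes Y :: "'i \<Rightarrow> 'a \<Rightarrow> real" and p :: real
  assumes "finite I" and "indep_vars (\<lambda>_. borel) Y I"
    and "\<And>i. i \<in> I \<Longrightarrow> expectation (Y i) = 0"
    and "\<And>i \<omega>. i \<in> I \<Longrightarrow> \<omega> \<in> space M \<Longrightarrow> \<bar>Y i \<omega>\<bar> \<le> 1"
    and "\<And>i. i \<in> I \<Longrightarrow> expectation (\<lambda>\<omega>. (Y i \<omega>)\<^sup>2) \<le> p"
  shows "expectation (\<lambda>\<omega>. (\<Sum>i\<in>I. Y i \<omega>)\<^sup>2) \<le> card I * p \<and>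
    expectation (\<lambda>\<omega>. (\<Sum>i\<in>I. Y i \<omega>) ^ 4) \<le> card I * p + 3 * (card I * p)\<^sup>2"
  using assms
proof (induction I rule: finite_induct)
  case empty
  then show ?case by simp
next
  case (insert i I)
  define S where "S = (\<lambda>\<omega>. \<Sum>j\<in>I. Y j \<omega>)"
  define N where "N = real (card I)"
  have IH: "expectation (\<lambda>\<omega>. (S \<omega>)\<^sup>2) \<le> N * p" "expectation (\<lambda>\<omega>. S \<omega> ^ 4) \<le> N * p + 3 * (N * p)\<^sup>2"
    using insert.IH[OF indep_vars_subset[OF insert.prems(1) subset_insertI]] insert.prems(2-4)
    unfolding S_def N_def by auto
  have rv[measurable]: "Y j \<in> borel_measurable M" if "j \<in> insert i I" for j
    using insert.prems(1) that by (auto simp: indep_vars_def)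
  have [measurable]: "S \<in> borel_measurable M"
    unfolding S_def by (intro borel_measurable_sum) (use rv in auto)
  have [measurable]: "Y i \<in> borel_measurable M" using rv by auto
  have ind: "indep_var borel (Y i) borel S"
    using indep_vars_sum[OF insert.hyps insert.prems(1)] unfolding S_def .
  have Ybd: "\<bar>Y i \<omega>\<bar> \<le> 1" if "\<omega> \<in> space M" for \<omega>
    using insert.prems(3) that by auto
  have Sbd: "\<bar>S \<omega>\<bar> \<le> N" if "\<omega> \<in> space M" for \<omega>
  proof -
    have "\<bar>S \<omega>\<bar> \<le> (\<Sum>j\<in>I. \<bar>Y j \<omega>\<bar>)" unfolding S_def by (rule sum_abs)
    also have "\<dots> \<le> (\<Sum>j\<in>I. 1)" by (intro sum_mono) (use insert.prems(3) that in auto)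
    finally show ?thesis by (simp add: N_def)
  qed
  have intS: "integrable M (\<lambda>\<omega>. S \<omega> ^ k)" for k
    by (intro integrable_const_bound[where B = "N ^ k"] AE_I2)
       (auto simp: power_abs intro!: power_mono Sbd)
  have intY: "integrable M (\<lambda>\<omega>. Y i \<omega> ^ k)" for k
    by (intro integrable_const_bound[where B = "1"] AE_I2)
       (auto simp: power_abs intro!: power_le_one Ybd)
  have ind': "indep_var borel (\<lambda>\<omega>. Y i \<omega> ^ l) borel (\<lambda>\<omega>. S \<omega> ^ k)" for k l
    using indep_var_compose[OF ind, of "\<lambda>x. x ^ l" borel "\<lambda>x. x ^ k" borel]
    by (simp add: comp_def)
  have prodE: "expectation (\<lambda>\<omega>. S \<omega> ^ k * Y i \<omega> ^ l) = expectation (\<lambda>\<omega>. S \<omega> ^ k) * expectation (\<lambda>\<omega>. Y i \<omega> ^ l)" for k l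
    using indep_var_lebesgue_integral[OF ind' intY intS] by (simp add: mult.commute)
  have intP[simp]: "integrable M (\<lambda>\<omega>. S \<omega> ^ k * Y i \<omega> ^ l)" for k l
    using indep_var_integrable[OF ind' intY intS] by (simp add: mult.commute)
  have Y0: "expectation (\<lambda>\<omega>. Y i \<omega> ^ 1) = 0"
    using insert.prems(2) by simp
  have S0: "expectation (\<lambda>\<omega>. S \<omega> ^ 1) = 0"
  proof -
    have "integrable M (Y j)" if "j \<in> I" for j
      by (intro integrable_const_bound[where B = "1"] AE_I2) (use that rv insert.prems(3) in auto)
    then have "expectation S = (\<Sum>j\<in>I. expectation (Y j))"
      unfolding S_def by (rule Bochner_Integration.integral_sum)
    then show ?thesis using insert.prems(2) by simp
  qed
  have Y2: "expectation (\<lambda>\<omega>. Y i \<omega> ^ 2) \<le> p"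
    using insert.prems(4) by auto
  have Y2_nonneg: "0 \<le> expectation (\<lambda>\<omega>. Y i \<omega> ^ 2)"
    by simp
  have Y4: "expectation (\<lambda>\<omega>. Y i \<omega> ^ 4) \<le> p"
  proof -
    have "expectation (\<lambda>\<omega>. Y i \<omega> ^ 4) \<le> expectation (\<lambda>\<omega>. Y i \<omega> ^ 2)"
    proof (rule integral_mono[OF intY intY])
      fix \<omega> assume "\<omega> \<in> space M"
      then have "\<bar>Y i \<omega>\<bar> ^ 4 \<le> \<bar>Y i \<omega>\<bar> ^ 2"
        by (intro power_decreasing) (use Ybd in auto)
      then show "Y i \<omega> ^ 4 \<le> Y i \<omega> ^ 2"
        by (simp add: power_even_abs)
    qed
    with Y2 show ?thesis by linarith
  qed
  have sum_eq: "(\<Sum>j\<in>insert i I. Y j \<omega>) = S \<omega> + Y i \<omega>" for \<omega>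
    using insert.hyps by (simp add: S_def)
  have E2: "expectation (\<lambda>\<omega>. (S \<omega> + Y i \<omega>)\<^sup>2) = expectation (\<lambda>\<omega>. S \<omega> ^ 2) + expectation (\<lambda>\<omega>. Y i \<omega> ^ 2)"
  proof -
    have "(S \<omega> + Y i \<omega>)\<^sup>2 = S \<omega> ^ 2 + 2 * (S \<omega> ^ 1 * Y i \<omega> ^ 1) + Y i \<omega> ^ 2" for \<omega>
      by (simp add: power2_sum)
    then have "expectation (\<lambda>\<omega>. (S \<omega> + Y i \<omega>)\<^sup>2) =
        expectation (\<lambda>\<omega>. S \<omega> ^ 2) + 2 * expectation (\<lambda>\<omega>. S \<omega> ^ 1 * Y i \<omega> ^ 1) + expectation (\<lambda>\<omega>. Y i \<omega> ^ 2)"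
      using intS[of 2] intY[of 2] intP[of 1 1] by (simp del: power_one_right)
    then show ?thesis
      unfolding prodE S0 Y0 by simp
  qed
  have E4: "expectation (\<lambda>\<omega>. (S \<omega> + Y i \<omega>) ^ 4) = expectation (\<lambda>\<omega>. S \<omega> ^ 4) +
      6 * (expectation (\<lambda>\<omega>. S \<omega> ^ 2) * expectation (\<lambda>\<omega>. Y i \<omega> ^ 2)) + expectation (\<lambda>\<omega>. Y i \<omega> ^ 4)"
  proof -
    have "(S \<omega> + Y i \<omega>) ^ 4 = S \<omega> ^ 4 + 4 * (S \<omega> ^ 3 * Y i \<omega> ^ 1) + 6 * (S \<omega> ^ 2 * Y i \<omega> ^ 2)
        + 4 * (S \<omega> ^ 1 * Y i \<omega> ^ 3) + Y i \<omega> ^ 4" for \<omega>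
      by (simp add: power2_eq_square power3_eq_cube power4_eq_xxxx algebra_simps)
    then have "expectation (\<lambda>\<omega>. (S \<omega> + Y i \<omega>) ^ 4) =
        expectation (\<lambda>\<omega>. S \<omega> ^ 4) + 4 * expectation (\<lambda>\<omega>. S \<omega> ^ 3 * Y i \<omega> ^ 1)
        + 6 * expectation (\<lambda>\<omega>. S \<omega> ^ 2 * Y i \<omega> ^ 2) + 4 * expectation (\<lambda>\<omega>. S \<omega> ^ 1 * Y i \<omega> ^ 3)
        + expectation (\<lambda>\<omega>. Y i \<omega> ^ 4)"
      using intS[of 4] intY[of 4] intP[of 3 1] intP[of 2 2] intP[of 1 3] by (simp del: power_one_right)
    then show ?thesis
      unfolding prodE S0 Y0 by simp
  qed
  have mix: "expectation (\<lambda>\<omega>. S \<omega> ^ 2) * expectation (\<lambda>\<omega>. Y i \<omega> ^ 2) \<le> (N * p) * p"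
    using IH(1) Y2 Y2_nonneg order_trans[OF Y2_nonneg Y2]
    by (intro mult_mono) (auto simp: N_def)
  have card: "real (card (insert i I)) = N + 1"
    using insert.hyps by (simp add: N_def)
  \<comment> \<open>In the next inequality the right side exceeds the left by exactly
    \<open>3 * p\<^sup>2\<close>.\<close>
  have "0 \<le> p\<^sup>2" by simp
  then have "N * p + 3 * (N * p)\<^sup>2 + 6 * ((N * p) * p) + p \<le> (N + 1) * p + 3 * ((N + 1) * p)\<^sup>2"
    by (simp add: power2_eq_square algebra_simps)
  then show ?case
    unfolding sum_eq card E2 E4 using IH Y2 Y4 mix by (auto simp: algebra_simps)
qed

text \<open>A dyadic chaining bound. At level \<open>k\<close>, each increment \<open>D\<close> over an interval of length
  \<open>2 ^ -k\<close> satisfies \<open>\<bar>D\<bar> / sqrt N \<le> t + D ^ 4 / (N\<^sup>2 t ^ 3)\<close> with \<open>t = (9/10) ^ k\<close>; the sum of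
  the second terms over the level has mean of order \<open>2 ^ -k / t ^ 3\<close>, which is summable since
  \<open>(9/10) ^ 3 > 1/2\<close>. Fourth moments are needed here: second moments would lose a logarithm.\<close>

lemma empirical_process_bound:
  fixes U :: "'i \<Rightarrow> 'a \<Rightarrow> real" and H :: "real \<Rightarrow> real" and L :: real
  assumes fin: "finite I" and indep: "indep_vars (\<lambda>_. borel) U I"
    and U01: "\<And>i \<omega>. i \<in> I \<Longrightarrow> \<omega> \<in> space M \<Longrightarrow> 0 \<le> U i \<omega> \<and> U i \<omega> \<le> 1"
    and H: "\<And>i u. i \<in> I \<Longrightarrow> prob {\<omega> \<in> space M. U i \<omega> \<le> u} = H u"
    and Lip: "\<And>a b. 0 \<le> a \<Longrightarrow> a \<le> b \<Longrightarrow> b \<le> 1 \<Longrightarrow> H b - H a \<le> L * (b - a)"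
    and L: "1 \<le> L"
  obtains B where "integrable M B" "\<And>\<omega>. 0 \<le> B \<omega>" "expectation B \<le> 27 * L\<^sup>2"
    "\<And>\<omega> u. \<omega> \<in> space M \<Longrightarrow>
      \<bar>(\<Sum>i\<in>I. of_bool (U i \<omega> \<le> u)) - card I * H u\<bar> \<le> sqrt (card I) * B \<omega>"
proof (cases "I = {}")
  case True
  show ?thesis
    by (rule that[of "\<lambda>_. 0"]) (use True in auto)
next
  case False
  define N where "N = real (card I)"
  have N1: "1 \<le> N"
    using False fin by (simp add: N_def Suc_le_eq card_gt_0_iff)
  obtain i0 where i0: "i0 \<in> I" using False by auto
  have [measurable]: "U i \<in> borel_measurable M" if "i \<in> I" for i
    using indep that by (auto simp: indep_vars_def)
  have Hmono: "H a \<le> H b" if "a \<le> b" for a b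
    unfolding H[OF i0, symmetric] by (rule finite_measure_mono) (use that i0 in auto)
  have H1: "H u = 1" if "1 \<le> u" for u
  proof -
    have "{\<omega> \<in> space M. U i0 \<omega> \<le> u} = space M"
      using U01[OF i0] that by force
    then show ?thesis unfolding H[OF i0, symmetric] by (simp add: prob_space)
  qed
  have H0: "H u = 0" if "u < 0" for u
  proof -
    have "{\<omega> \<in> space M. U i0 \<omega> \<le> u} = {}"
      using U01[OF i0] that by force
    then show ?thesis unfolding H[OF i0, symmetric] by (simp only: measure_empty)
  qed
  have H01: "0 \<le> H u" "H u \<le> 1" for u
    unfolding H[OF i0, symmetric] by auto
  \<comment> \<open>\<open>K\<close> is the finest level of the chain. \<open>N \<le> 4 ^ K\<close>
    makes the mesh at most \<open>1 / sqrt N\<close>, so that stopping there is harmless;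
    \<open>4 ^ K \<le> 4 * N\<close> keeps the intervals long enough for the fourth moments to
    behave like squared variances.\<close>
  define K where "K = (LEAST k. N \<le> 4 ^ k)"
  obtain k0 :: nat where "N < 4 ^ k0"
    using real_arch_pow[of 4 N] by auto
  then have "N \<le> 4 ^ k0" by simp
  then have K1: "N \<le> 4 ^ K"
    unfolding K_def by (rule LeastI)
  have K2: "4 ^ K \<le> 4 * N"
  proof (cases K)
    case 0 then show ?thesis using N1 by simp
  next
    case (Suc k)
    then have "\<not> N \<le> 4 ^ k" unfolding K_def by (metis not_less_Least lessI)
    then show ?thesis using Suc by simp
  qed
  have sqrtK: "sqrt N \<le> 2 ^ K"
    by (rule real_le_lsqrt) (use N1 K1 in \<open>simp_all add: power2_eq_square flip: power_mult_distrib\<close>)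
  define S where "S = (\<lambda>u \<omega>. (\<Sum>i\<in>I. of_bool (U i \<omega> \<le> u)) - N * H u)"
  define D where "D = (\<lambda>k j \<omega>. S (real (Suc j) / 2 ^ k) \<omega> - S (real j / 2 ^ k) \<omega>)"
  define t :: "nat \<Rightarrow> real" where "t = (\<lambda>k. (9/10) ^ k)"
  define b where "b = (\<lambda>k \<omega>. t k + (\<Sum>j<2^k. D k j \<omega> ^ 4) / (N\<^sup>2 * t k ^ 3))"
  \<comment> \<open>The sum pays for the increments down to level \<open>K\<close>, and
    \<open>L\<close> for the passage from the finest grid to an arbitrary \<open>u\<close>.\<close>
  define B where "B = (\<lambda>\<omega>. L + (\<Sum>k\<le>K. b k \<omega>))"
  have tpos: "0 < t k" for k by (simp add: t_def)
  have b_nonneg: "0 \<le> b k \<omega>" for k \<omega>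
    unfolding b_def using tpos[of k] by (intro add_nonneg_nonneg divide_nonneg_nonneg sum_nonneg) auto
  have S_meas[measurable]: "S u \<in> borel_measurable M" for u
    unfolding S_def by measurable
  have D_meas[measurable]: "D k j \<in> borel_measurable M" for k j
    unfolding D_def by measurable
  have S_bd: "\<bar>S u \<omega>\<bar> \<le> N" for u \<omega>
  proof -
    have "(\<Sum>i\<in>I. of_bool (U i \<omega> \<le> u) :: real) \<le> (\<Sum>i\<in>I. 1)" by (intro sum_mono) auto
    moreover have "(0::real) \<le> (\<Sum>i\<in>I. of_bool (U i \<omega> \<le> u))" by (intro sum_nonneg) auto
    moreover have "0 \<le> N * H u" "N * H u \<le> N * 1"
      using H01[of u] N1 by (auto intro: mult_left_mono)
    ultimately show ?thesis unfolding S_def by (auto simp: N_def)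
  qed
  have D_bd: "\<bar>D k j \<omega>\<bar> \<le> 2 * N" for k j \<omega>
    unfolding D_def using S_bd[of "real (Suc j) / 2 ^ k" \<omega>] S_bd[of "real j / 2 ^ k" \<omega>] by linarith
  have D_int: "integrable M (\<lambda>\<omega>. D k j \<omega> ^ 4)" for k j
  proof (rule integrable_const_bound[where B = "(2 * N) ^ 4"])
    have "norm (D k j \<omega> ^ 4) \<le> (2 * N) ^ 4" for \<omega>
      unfolding real_norm_def power_abs by (intro power_mono D_bd) simp
    then show "AE \<omega> in M. norm (D k j \<omega> ^ 4) \<le> (2 * N) ^ 4"
      by simp
  qed measurable
  have D_moment: "expectation (\<lambda>\<omega>. D k j \<omega> ^ 4) \<le> 5 * L\<^sup>2 * N\<^sup>2 / 4 ^ k" if k: "k \<le> K" and j: "j < 2 ^ k" for k j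
  proof -
    define u v where "u = real j / 2 ^ k" and "v = real (Suc j) / 2 ^ k"
    have uv: "0 \<le> u" "u \<le> v" "v - u = 1 / 2 ^ k"
      by (auto simp: u_def v_def field_simps)
    have "real (Suc j) \<le> 2 ^ k"
      using j by (metis Suc_leI of_nat_le_iff of_nat_numeral of_nat_power)
    then have v1: "v \<le> 1" by (simp add: v_def)
    define p where "p = H v - H u"
    have p: "0 \<le> p" "p \<le> L / 2 ^ k" "p \<le> 1"
      using Hmono[OF uv(2)] Lip[OF uv(1,2) v1] uv(3) H01[of u] H01[of v] by (auto simp: p_def)
    \<comment> \<open>Centred indicators of the interval from \<open>u\<close> to \<open>v\<close>,
      open on the left: their sum is the increment \<open>D k j\<close>, and their variance is at
      most \<open>p\<close>.\<close>
    define Y where "Y = (\<lambda>i \<omega>. of_bool (u < U i \<omega> \<and> U i \<omega> \<le> v) - p)"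
    have DY: "D k j \<omega> = (\<Sum>i\<in>I. Y i \<omega>)" for \<omega>
    proof -
      have "of_bool (U i \<omega> \<le> v) = (of_bool (U i \<omega> \<le> u) + of_bool (u < U i \<omega> \<and> U i \<omega> \<le> v) :: real)" for i
        using uv(2) by auto
      then have "(\<Sum>i\<in>I. of_bool (U i \<omega> \<le> v) :: real) =
          (\<Sum>i\<in>I. of_bool (U i \<omega> \<le> u)) + (\<Sum>i\<in>I. of_bool (u < U i \<omega> \<and> U i \<omega> \<le> v))"
        by (simp only: sum.distrib)
      then show ?thesis
        unfolding D_def S_def Y_def u_def[symmetric] v_def[symmetric]
        by (simp add: p_def N_def algebra_simps sum_subtractf sum.distrib)
    qed
    have indY: "indep_vars (\<lambda>_. borel) Y I"
      unfolding Y_def by (rule indep_vars_compose2[OF indep]) measurable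
    have prob_uv: "expectation (\<lambda>\<omega>. of_bool (u < U i \<omega> \<and> U i \<omega> \<le> v)) = p" if "i \<in> I" for i
    proof -
      have "expectation (\<lambda>\<omega>. of_bool (u < U i \<omega> \<and> U i \<omega> \<le> v))
          = expectation (indicator ({\<omega> \<in> space M. U i \<omega> \<le> v} - {\<omega> \<in> space M. U i \<omega> \<le> u}))"
        by (intro Bochner_Integration.integral_cong) (auto simp: indicator_def)
      also have "\<dots> = prob ({\<omega> \<in> space M. U i \<omega> \<le> v} - {\<omega> \<in> space M. U i \<omega> \<le> u})"
        using that by (subst Bochner_Integration.integral_indicator) (auto simp: emeasure_eq_measure)
      also have "\<dots> = H v - H u"
        unfolding H[OF that, symmetric]
        by (intro finite_measure_Diff) (use that uv in auto)
      finally show ?thesis by (simp add: p_def)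
    qed
    have int_uv: "integrable M (\<lambda>\<omega>. of_bool (u < U i \<omega> \<and> U i \<omega> \<le> v) :: real)" if "i \<in> I" for i
      by (intro integrable_const_bound[where B = 1]) (use that in auto)
    have EY: "expectation (Y i) = 0" if "i \<in> I" for i
      unfolding Y_def using prob_uv[OF that] int_uv[OF that] by (simp add: prob_space)
    have EY2: "expectation (\<lambda>\<omega>. (Y i \<omega>)\<^sup>2) \<le> p" if "i \<in> I" for i
    proof -
      have "(Y i \<omega>)\<^sup>2 = (1 - 2 * p) * of_bool (u < U i \<omega> \<and> U i \<omega> \<le> v) + p\<^sup>2" for \<omega>
        by (simp add: Y_def power2_eq_square algebra_simps)
      then have "expectation (\<lambda>\<omega>. (Y i \<omega>)\<^sup>2) = (1 - 2 * p) * p + p\<^sup>2"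
        using prob_uv[OF that] int_uv[OF that] by (simp add: prob_space)
      also have "\<dots> \<le> p" by (simp add: power2_eq_square algebra_simps)
      finally show ?thesis .
    qed
    have "expectation (\<lambda>\<omega>. D k j \<omega> ^ 4) \<le> N * p + 3 * (N * p)\<^sup>2"
      unfolding DY N_def
      by (rule conjunct2[OF expectation_sum_square_pow4_le[OF fin indY EY _ EY2]])
         (use p in \<open>auto simp: Y_def\<close>)
    also have "\<dots> \<le> N * (L / 2 ^ k) + 3 * (N * (L / 2 ^ k))\<^sup>2"
      using p N1 by (intro add_mono mult_left_mono power_mono) auto
    \<comment> \<open>The quadratic term contributes 3 of the 5. The linear term contributes 2,
      because \<open>2 ^ k \<le> 2 * N\<close> on the levels up to \<open>K\<close> and
      \<open>L \<le> L * L\<close>.\<close>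
    also have "\<dots> \<le> 5 * L\<^sup>2 * N\<^sup>2 / 4 ^ k"
    proof -
      have "(2::real) ^ k * 2 ^ k = 4 ^ k" by (simp flip: power_mult_distrib)
      have "(2::real) ^ k \<le> 2 * N"
      proof (rule power2_le_imp_le)
        have "((2::real) ^ k)\<^sup>2 = 4 ^ k" by (simp add: power2_eq_square flip: power_mult_distrib)
        also have "\<dots> \<le> 4 ^ K" using k by simp
        also have "\<dots> \<le> 4 * N" by (rule K2)
        also have "\<dots> \<le> (2 * N)\<^sup>2" using N1 by (simp add: power2_eq_square)
        finally show "((2::real) ^ k)\<^sup>2 \<le> (2 * N)\<^sup>2" .
      qed (use N1 in simp)
      moreover have "L \<le> L * L" using L by simp
      ultimately have "L * 2 ^ k \<le> (L * L) * (2 * N)" using L by (intro mult_mono) auto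
      then have "N * (L * 2 ^ k) \<le> N * ((L * L) * (2 * N))" using N1 by (intro mult_left_mono) auto
      then have "N * (L / 2 ^ k) \<le> 2 * (L\<^sup>2 * N\<^sup>2 / 4 ^ k)"
        unfolding \<open>2 ^ k * 2 ^ k = 4 ^ k\<close>[symmetric] by (simp add: field_simps power2_eq_square)
      moreover have "(N * (L / 2 ^ k))\<^sup>2 = L\<^sup>2 * N\<^sup>2 / 4 ^ k"
        unfolding \<open>2 ^ k * 2 ^ k = 4 ^ k\<close>[symmetric] by (simp add: field_simps power2_eq_square)
      moreover have "5 * L\<^sup>2 * N\<^sup>2 / 4 ^ k = 5 * (L\<^sup>2 * N\<^sup>2 / 4 ^ k)" by simp
      ultimately show ?thesis by linarith
    qed
    finally show ?thesis .
  qed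
  have b_int: "integrable M (b k)" for k
    unfolding b_def using D_int by auto
  have b_exp: "expectation (b k) \<le> (9/10) ^ k + 5 * L\<^sup>2 * (500/729) ^ k" if "k \<le> K" for k
  proof -
    have Nt: "0 < N\<^sup>2 * t k ^ 3" using N1 tpos[of k] by simp
    have "expectation (b k) = t k + (\<Sum>j<2^k. expectation (\<lambda>\<omega>. D k j \<omega> ^ 4)) / (N\<^sup>2 * t k ^ 3)"
      unfolding b_def using D_int by (simp add: prob_space)
    also have "\<dots> \<le> t k + (\<Sum>j<(2::nat)^k. 5 * L\<^sup>2 * N\<^sup>2 / 4 ^ k) / (N\<^sup>2 * t k ^ 3)"
      using Nt D_moment[OF that] by (intro add_left_mono divide_right_mono sum_mono) auto
    also have "(\<Sum>j<(2::nat)^k. 5 * L\<^sup>2 * N\<^sup>2 / 4 ^ k) = 5 * L\<^sup>2 * N\<^sup>2 / 2 ^ k"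
    proof -
      have "(4::real) ^ k = 2 ^ k * 2 ^ k" by (simp flip: power_mult_distrib)
      then show ?thesis by simp
    qed
    also have "5 * L\<^sup>2 * N\<^sup>2 / 2 ^ k / (N\<^sup>2 * t k ^ 3) = 5 * L\<^sup>2 * (1 / (2 ^ k * t k ^ 3))"
      using N1 by (simp add: field_simps)
    also have "1 / (2 ^ k * t k ^ 3) = (500/729) ^ k"
    proof -
      have "2 ^ k * t k ^ 3 = (2 * (9/10) ^ 3) ^ k"
        unfolding t_def power_mult_distrib by (simp add: mult.commute flip: power_mult)
      also have "2 * (9/10) ^ 3 = (729/500 :: real)" by (simp add: power3_eq_cube)
      finally show ?thesis by (simp add: power_divide)
    qed
    finally show ?thesis by (simp add: t_def)
  qed
  have geo: "(\<Sum>k\<le>K. x ^ k) \<le> 1 / (1 - x)" if "0 \<le> x" "x < 1" for x :: real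
  proof -
    have "(\<Sum>k\<le>K. x ^ k) = (1 - x ^ Suc K) / (1 - x)"
      using sum_gp_basic[of x K] that by (simp add: field_simps)
    also have "\<dots> \<le> 1 / (1 - x)" using that by (intro divide_right_mono) auto
    finally show ?thesis .
  qed
  have B_int: "integrable M B" unfolding B_def using b_int by auto
  have B_nonneg: "0 \<le> B \<omega>" for \<omega>
    unfolding B_def using b_nonneg L by (intro add_nonneg_nonneg sum_nonneg) auto
  have B_exp: "expectation B \<le> 27 * L\<^sup>2"
  proof -
    have "expectation B = L + (\<Sum>k\<le>K. expectation (b k))"
      unfolding B_def using b_int by (simp add: prob_space)
    also have "\<dots> \<le> L + (\<Sum>k\<le>K. (9/10) ^ k + 5 * L\<^sup>2 * (500/729) ^ k)"
      by (intro add_left_mono sum_mono b_exp) auto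
    also have "\<dots> = L + (\<Sum>k\<le>K. (9/10) ^ k) + 5 * L\<^sup>2 * (\<Sum>k\<le>K. (500/729) ^ k)"
      by (simp add: sum.distrib sum_distrib_left)
    \<comment> \<open>Geometric series: the first has limit 10, the second 729/229, which is below
      16/5. Then 27 = 1 + 10 + 16, as 1 and \<open>L\<close> are at most
      \<open>L\<^sup>2\<close>.\<close>
    also have "\<dots> \<le> L + 10 + 5 * L\<^sup>2 * (16/5)"
    proof (intro add_mono mult_left_mono)
      show "(\<Sum>k\<le>K. (9/10) ^ k) \<le> (10::real)" using geo[of "9/10"] by simp
      show "(\<Sum>k\<le>K. (500/729) ^ k) \<le> (16/5::real)" using geo[of "500/729"] by simp
    qed auto
    also have "\<dots> \<le> 27 * L\<^sup>2"
    proof -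
      have "1 \<le> L\<^sup>2" "L \<le> L\<^sup>2" using L by (auto simp: power2_eq_square mult_ge1_I)
      then show ?thesis by linarith
    qed
    finally show ?thesis .
  qed
  have D_le: "\<bar>D k j \<omega>\<bar> \<le> sqrt N * b k \<omega>" if "j < 2 ^ k" for k j \<omega>
  proof -
    define y where "y = \<bar>D k j \<omega>\<bar> / sqrt N"
    have y0: "0 \<le> y" using N1 by (simp add: y_def)
    have "y \<le> t k + y ^ 4 / t k ^ 3"
    proof (cases "y \<le> t k")
      case True
      moreover have "0 \<le> y ^ 4 / t k ^ 3" using y0 tpos[of k] by simp
      ultimately show ?thesis by linarith
    next
      case False
      then have "t k ^ 3 \<le> y ^ 3" using tpos[of k] by (intro power_mono) auto
      then have "y * t k ^ 3 \<le> y * y ^ 3" using y0 by (rule mult_left_mono)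
      also have "y * y ^ 3 = y ^ 4" by (simp add: power3_eq_cube power4_eq_xxxx)
      finally have "y \<le> y ^ 4 / t k ^ 3" using tpos[of k] by (simp add: field_simps)
      then show ?thesis using tpos[of k] by linarith
    qed
    also have "y ^ 4 = D k j \<omega> ^ 4 / N\<^sup>2"
    proof -
      have "sqrt N ^ 4 = N\<^sup>2"
        using N1 power_mult[of "sqrt N" 2 2] by simp
      then show ?thesis by (simp add: y_def power_divide power_even_abs)
    qed
    also have "D k j \<omega> ^ 4 / N\<^sup>2 / t k ^ 3 = D k j \<omega> ^ 4 / (N\<^sup>2 * t k ^ 3)" by simp
    \<comment> \<open>Replacing one increment by the sum over its level gives a bound that serves
      all \<open>j\<close> at once, in place of a maximum.\<close>
    also have "\<dots> \<le> (\<Sum>j<2^k. D k j \<omega> ^ 4) / (N\<^sup>2 * t k ^ 3)"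
      using tpos[of k] that
      by (intro divide_right_mono member_le_sum[of j "{..<2^k}" "\<lambda>j. D k j \<omega> ^ 4"]) auto
    finally have "y \<le> b k \<omega>" by (simp add: b_def)
    then show ?thesis using N1 by (simp add: y_def field_simps)
  qed
  have S_grid: "\<bar>S (real j / 2 ^ k) \<omega>\<bar> \<le> sqrt N * (\<Sum>l\<le>k. b l \<omega>)" if "j \<le> 2 ^ k" "\<omega> \<in> space M" for k j \<omega>
    using that(1)
  proof (induction k arbitrary: j)
    case 0
    \<comment> \<open>At 1 the count is exact. \<open>S 0\<close> need not vanish, since the common
      law may have an atom at 0; it is reached from \<open>S 1\<close> through the increment
      \<open>D 0 0\<close>.\<close>
    have S1: "S 1 \<omega> = 0"
    proof -
      have "(\<Sum>i\<in>I. of_bool (U i \<omega> \<le> 1) :: real) = (\<Sum>i\<in>I. 1)"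
        by (intro sum.cong) (use U01 that in auto)
      then show ?thesis by (simp add: S_def H1 N_def)
    qed
    have "\<bar>S 0 \<omega>\<bar> \<le> sqrt N * b 0 \<omega>"
      using D_le[of 0 0 \<omega>] S1 by (simp add: D_def)
    moreover have "0 \<le> sqrt N * b 0 \<omega>" using N1 b_nonneg by simp
    moreover have "j = 0 \<or> j = 1" using 0 by auto
    ultimately show ?case using S1 by auto
  next
    case (Suc k)
    have nn: "0 \<le> sqrt N * b (Suc k) \<omega>" using N1 b_nonneg by simp
    show ?case
    \<comment> \<open>An even point already lies on the coarser grid; an odd point is one increment
      of the new level to the right of such a point. Each level is therefore charged at most
      once.\<close>
    proof (cases "even j")
      case True
      then obtain i where i: "j = 2 * i" by (elim evenE)
      then have "real j / 2 ^ Suc k = real i / 2 ^ k" by simp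
      then show ?thesis
        using Suc.IH[of i] Suc.prems i nn by (simp add: distrib_left)
    next
      case False
      then obtain i where i: "j = 2 * i + 1" by (elim oddE)
      have "real (2 * i) / 2 ^ Suc k = real i / 2 ^ k" by simp
      then have "S (real j / 2 ^ Suc k) \<omega> = S (real i / 2 ^ k) \<omega> + D (Suc k) (2 * i) \<omega>"
        by (simp add: D_def i del: power_Suc)
      then show ?thesis
        using Suc.IH[of i] Suc.prems i D_le[of "2 * i" "Suc k" \<omega>] by (simp add: distrib_left)
    qed
  qed
  have main: "\<bar>S u \<omega>\<bar> \<le> sqrt N * B \<omega>" if \<omega>: "\<omega> \<in> space M" for u \<omega>
  proof -
    have nn: "0 \<le> sqrt N * B \<omega>" using N1 B_nonneg by simp
    consider "u < 0" | "1 \<le> u" | "0 \<le> u" "u < 1" by linarith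
    then show ?thesis
    proof cases
      case 1
      then have "(\<Sum>i\<in>I. of_bool (U i \<omega> \<le> u) :: real) = (\<Sum>i\<in>I. 0)"
        by (intro sum.cong) (use U01 \<omega> in force)+
      then show ?thesis using nn 1 by (simp add: S_def H0)
    next
      case 2
      then have "(\<Sum>i\<in>I. of_bool (U i \<omega> \<le> u) :: real) = (\<Sum>i\<in>I. 1)"
        by (intro sum.cong) (use U01 \<omega> in force)+
      then show ?thesis using nn 2 by (simp add: S_def H1 N_def)
    next
      case 3
      define j where "j = nat \<lfloor>u * 2 ^ K\<rfloor>"
      \<comment> \<open>The neighbours of \<open>u\<close> on the finest grid. Both the count and
        \<open>N * H\<close> are monotone, so \<open>S u\<close> differs from one of
        \<open>S a\<close>, \<open>S c\<close> by at most \<open>N * (H c - H a)\<close>, which the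
        Lipschitz bound and the choice of \<open>K\<close> keep below
        \<open>sqrt N * L\<close>.\<close>
      define a c where "a = real j / 2 ^ K" and "c = real (Suc j) / 2 ^ K"
      have fl: "real j = of_int \<lfloor>u * 2 ^ K\<rfloor>" using 3 by (simp add: j_def)
      have "real j \<le> u * 2 ^ K" "u * 2 ^ K < real j + 1" unfolding fl by linarith+
      then have ac: "a \<le> u" "u \<le> c" by (auto simp: a_def c_def field_simps)
      have "u * 2 ^ K < 2 ^ K" using 3 by simp
      then have "real j < 2 ^ K" using \<open>real j \<le> u * 2 ^ K\<close> by linarith
      then have j: "j < 2 ^ K" by (metis of_nat_less_iff of_nat_numeral of_nat_power)
      then have "real (Suc j) \<le> real (2 ^ K)" by (simp only: of_nat_le_iff Suc_le_eq)
      then have c1: "c \<le> 1" by (simp add: c_def)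
      have a0: "0 \<le> a" by (simp add: a_def)
      have ca: "c - a = 1 / 2 ^ K" by (simp add: a_def c_def field_simps)
      have Hca: "N * (H c - H a) \<le> sqrt N * L"
      proof -
        have "N * (H c - H a) \<le> N * (L / 2 ^ K)"
          using Lip[OF a0 _ c1] ac ca N1 by (intro mult_left_mono) auto
        also have "\<dots> \<le> sqrt N * L"
        proof -
          have "sqrt N * (sqrt N * L) \<le> sqrt N * (2 ^ K * L)"
            using sqrtK L N1 by (intro mult_left_mono mult_right_mono) auto
          moreover have "sqrt N * (sqrt N * L) = N * L" using N1 by (simp flip: mult.assoc)
          ultimately have "N * L \<le> (sqrt N * L) * 2 ^ K" by (simp only: mult_ac)
          then show ?thesis by (simp add: divide_le_eq)
        qed
        finally show ?thesis .
      qed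
      have g: "\<bar>S a \<omega>\<bar> \<le> sqrt N * (\<Sum>l\<le>K. b l \<omega>)" "\<bar>S c \<omega>\<bar> \<le> sqrt N * (\<Sum>l\<le>K. b l \<omega>)"
        unfolding a_def c_def by (intro S_grid \<omega>; use j in simp)+
      have cnt: "(\<Sum>i\<in>I. of_bool (U i \<omega> \<le> a) :: real) \<le> (\<Sum>i\<in>I. of_bool (U i \<omega> \<le> u))"
        "(\<Sum>i\<in>I. of_bool (U i \<omega> \<le> u) :: real) \<le> (\<Sum>i\<in>I. of_bool (U i \<omega> \<le> c))"
        using ac by (auto intro!: sum_mono)
      have "N * H a \<le> N * H u" "N * H u \<le> N * H c"
        using N1 ac by (auto intro!: mult_left_mono Hmono)
      with cnt g Hca show ?thesis
        unfolding S_def B_def by (simp add: algebra_simps)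
    qed
  qed
  show ?thesis
    by (rule that[OF B_int B_nonneg B_exp]) (use main in \<open>simp add: S_def N_def\<close>)
qed

end

section \<open>Exchangeability within the second block\<close>

text \<open>The entries at most \<open>t\<close> form an initial segment of a sorted list, so their
  number decides which positions they occupy.\<close>

lemma sorted_nth_le_iff:
  fixes ys :: "'b::linorder list"
  assumes "sorted ys" "i < length ys"
  shows "ys ! i \<le> t \<longleftrightarrow> i < length (filter (\<lambda>y. y \<le> t) ys)"
  using assms
proof (induction ys arbitrary: i)
  case (Cons y ys)
  show ?case
  proof (cases "y \<le> t")
    case True
    then show ?thesis using Cons by (cases i) auto
  next
    case False
    then have "filter (\<lambda>y. y \<le> t) (y # ys) = []"
      using Cons.prems by (auto simp: filter_empty_conv)
    moreover have "y \<le> (y # ys) ! i"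
      using Cons.prems by (cases i) auto
    ultimately show ?thesis using False by auto
  qed
qed simp

text \<open>Reduces sublevel sets of order statistics to counts, whose measurability is immediate.
  Positions in the list start at 0 and \<open>k\<close> at 1, which turns the strict inequality into
  a weak one.\<close>

lemma order_stat_le_iff:
  assumes "1 \<le> k" "k \<le> n"
  shows "order_stat n x k \<le> t \<longleftrightarrow> real k \<le> (\<Sum>i=1..n. of_bool (x i \<le> t))"
proof -
  have "length (filter (\<lambda>y. y \<le> t) (sort (map x [1..<Suc n]))) = length (filter (\<lambda>i. x i \<le> t) [1..<Suc n])"
    by (simp add: filter_sort comp_def filter_map del: upt_Suc)
  also have "\<dots> = card {i \<in> {1..n}. x i \<le> t}"
    by (subst distinct_length_filter) (auto intro!: arg_cong[of _ _ card] simp del: upt_Suc)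
  also have "real \<dots> = (\<Sum>i=1..n. of_bool (x i \<le> t))"
    by (simp add: of_bool_def sum.If_cases Int_def)
  finally show ?thesis
    using sorted_nth_le_iff[of "sort (map x [1..<Suc n])" "k - 1" t] assms
    by (auto simp: order_stat_def simp del: upt_Suc)
qed

lemma order_stat_permute:
  assumes "\<sigma> permutes {1..n}"
  shows "order_stat n (\<lambda>i. x (\<sigma> i)) k = order_stat n x k"
proof -
  have "image_mset (\<lambda>i. x (\<sigma> i)) (mset_set {1..n}) = image_mset x (image_mset \<sigma> (mset_set {1..n}))"
    by (simp add: multiset.map_comp comp_def)
  also have "image_mset \<sigma> (mset_set {1..n}) = mset_set {1..n}"
    using permutes_inj_on[OF assms] permutes_image[OF assms] by (simp add: image_mset_mset_set)
  finally have "mset (map (\<lambda>i. x (\<sigma> i)) [1..<Suc n]) = mset (map x [1..<Suc n])"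
    by (simp add: atLeastLessThanSuc_atLeastAtMost del: upt_Suc)
  then have "sort (map (\<lambda>i. x (\<sigma> i)) [1..<Suc n]) = sort (map x [1..<Suc n])"
    by (intro properties_for_sort) (auto simp del: upt_Suc)
  then show ?thesis by (simp add: order_stat_def)
qed

lemma measurable_order_stat:
  assumes "\<And>i. i \<in> {1..n} \<Longrightarrow> Y i \<in> borel_measurable N"
  shows "(\<lambda>\<omega>. \<lambda>k\<in>{1..n}. order_stat n (\<lambda>i. Y i \<omega>) k) \<in> measurable N (PiM {1..n} (\<lambda>_. borel))"
proof (rule measurable_restrict)
  fix k assume k: "k \<in> {1..n}"
  show "(\<lambda>\<omega>. order_stat n (\<lambda>i. Y i \<omega>) k) \<in> borel_measurable N"
  proof (rule borel_measurableI_le)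
    fix t
    have "(\<lambda>\<omega>. \<Sum>i=1..n. of_bool (Y i \<omega> \<le> t) :: real) \<in> borel_measurable N"
    proof (intro borel_measurable_sum)
      fix i assume "i \<in> {1..n}"
      note [measurable] = assms[OF this]
      show "(\<lambda>\<omega>. of_bool (Y i \<omega> \<le> t) :: real) \<in> borel_measurable N" by measurable
    qed
    then have "{\<omega> \<in> space N. real k \<le> (\<Sum>i=1..n. of_bool (Y i \<omega> \<le> t))} \<in> sets N"
      by (intro borel_measurable_le borel_measurable_const)
    then show "{\<omega> \<in> space N. order_stat n (\<lambda>i. Y i \<omega>) k \<le> t} \<in> sets N"
      using k by (simp only: order_stat_le_iff atLeastAtMost_iff)
  qed
qed

section \<open>The law of a row and its invariance under transpositions\<close>

locale two_sample_row = prob_space M for M :: "'a measure" +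
  fixes R Q :: "real measure" and X :: "nat \<Rightarrow> nat \<Rightarrow> 'a \<Rightarrow> real" and s n :: nat
  assumes R: "real_distribution R" and Q: "real_distribution Q" and sn: "s < n"
    and iid_R: "iid M R (X n) {1..s}" and iid_Q: "iid M Q (X n) {s + 1..n}"
    and indep_blocks: "indep_var
        (PiM {1..s} (\<lambda>_. borel)) (\<lambda>\<omega>. \<lambda>j\<in>{1..s}. X n j \<omega>)
        (PiM {s + 1..n} (\<lambda>_. borel)) (\<lambda>\<omega>. \<lambda>j\<in>{s + 1..n}. X n j \<omega>)"
begin

definition row :: "'a \<Rightarrow> nat \<Rightarrow> real" where
  "row \<omega> = (\<lambda>i\<in>{1..n}. X n i \<omega>)"

text \<open>A single family for both blocks, so that the law of \<open>row\<close> is one product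
  measure over \<open>{1..n}\<close>.\<close>

definition law :: "nat \<Rightarrow> real measure" where
  "law i = (if i \<le> s then R else Q)"

abbreviation G :: "'a measure" where
  "G \<equiv> row_algebra M X n"

lemma sets_law [simp, measurable_cong]: "sets (law i) = sets borel"
  using R Q by (auto simp: law_def real_distribution_def real_distribution_axioms_def)

lemma prob_space_law: "prob_space (law i)"
  using R Q by (auto simp: law_def real_distribution_def)

lemma measurable_entry [measurable]: "i \<in> {1..n} \<Longrightarrow> X n i \<in> borel_measurable M"
  using iid_R iid_Q by (cases "i \<le> s") (auto simp: iid_def indep_vars_def)

lemma distr_entry: "i \<in> {1..n} \<Longrightarrow> distr M borel (X n i) = law i"
  using iid_R iid_Q by (cases "i \<le> s") (auto simp: iid_def law_def)

lemma measurable_row [measurable]: "row \<in> measurable M (PiM {1..n} (\<lambda>_. borel))"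
  unfolding row_def by measurable

lemma distr_block:
  assumes "indep_vars (\<lambda>_. borel) (X n) I" "finite I" "I \<subseteq> {1..n}"
  shows "distr M (PiM I (\<lambda>_. borel)) (\<lambda>\<omega>. \<lambda>j\<in>I. X n j \<omega>) = PiM I law"
\<comment> \<open>The first block is empty when \<open>s = 0\<close>, whereas the characterisation
  of independence by product laws applied below takes a nonempty index set.\<close>
proof (cases "I = {}")
  case True
  interpret L: product_prob_space law by (intro product_prob_spaceI prob_space_law)
  show ?thesis
  proof (rule L.PiM_eqI)
    fix A :: "nat \<Rightarrow> real set"
    show "emeasure (distr M (PiM I (\<lambda>_. borel)) (\<lambda>\<omega>. \<lambda>j\<in>I. X n j \<omega>)) (Pi\<^sub>E I A) = (\<Prod>i\<in>I. emeasure (law i) (A i))"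
      using True by (subst emeasure_distr) (auto simp: PiM_empty restrict_def emeasure_space_1 intro!: measurable_restrict)
  qed (use True in \<open>auto simp: PiM_empty\<close>)
next
  case False
  have "distr M (PiM I (\<lambda>_. borel)) (\<lambda>\<omega>. \<lambda>j\<in>I. X n j \<omega>) = PiM I (\<lambda>i. distr M borel (X n i))"
    using assms by (subst indep_vars_iff_distr_eq_PiM'[OF False, symmetric]) auto
  also have "\<dots> = PiM I law"
    using assms distr_entry by (intro PiM_cong) auto
  finally show ?thesis .
qed

lemma distr_row: "distr M (PiM {1..n} (\<lambda>_. borel)) row = PiM {1..n} law"
proof -
  let ?I = "{1..s}" and ?J = "{s + 1..n}"
  interpret L: product_prob_space law by (intro product_prob_spaceI prob_space_law)
  have IJ: "?I \<union> ?J = {1..n}" using sn by auto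
  have I: "distr M (PiM ?I (\<lambda>_. borel)) (\<lambda>\<omega>. \<lambda>j\<in>?I. X n j \<omega>) = PiM ?I law"
    by (rule distr_block) (use iid_R sn in \<open>auto simp: iid_def\<close>)
  have J: "distr M (PiM ?J (\<lambda>_. borel)) (\<lambda>\<omega>. \<lambda>j\<in>?J. X n j \<omega>) = PiM ?J law"
    by (rule distr_block) (use iid_Q in \<open>auto simp: iid_def\<close>)
  let ?b = "\<lambda>\<omega>. ((\<lambda>j\<in>?I. X n j \<omega>), (\<lambda>j\<in>?J. X n j \<omega>))"
  have b: "?b \<in> measurable M (PiM ?I (\<lambda>_. borel) \<Otimes>\<^sub>M PiM ?J (\<lambda>_. borel))"
    using indep_blocks unfolding indep_var_distribution_eq by (intro measurable_Pair) auto
  have row: "row = merge ?I ?J \<circ> ?b"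
    using sn by (auto simp: row_def merge_def fun_eq_iff)
  have "distr M (PiM {1..n} (\<lambda>_. borel)) row =
      distr (distr M (PiM ?I (\<lambda>_. borel) \<Otimes>\<^sub>M PiM ?J (\<lambda>_. borel)) ?b) (PiM (?I \<union> ?J) (\<lambda>_. borel)) (merge ?I ?J)"
    unfolding row IJ[symmetric] by (rule distr_distr[symmetric, OF measurable_merge b])
  also have "distr M (PiM ?I (\<lambda>_. borel) \<Otimes>\<^sub>M PiM ?J (\<lambda>_. borel)) ?b = PiM ?I law \<Otimes>\<^sub>M PiM ?J law"
    using indep_blocks unfolding indep_var_distribution_eq I J by auto
  also have "distr (PiM ?I law \<Otimes>\<^sub>M PiM ?J law) (PiM (?I \<union> ?J) (\<lambda>_. borel)) (merge ?I ?J) =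
      distr (PiM ?I law \<Otimes>\<^sub>M PiM ?J law) (PiM (?I \<union> ?J) law) (merge ?I ?J)"
    by (intro distr_cong sets_PiM_cong) auto
  also have "\<dots> = PiM (?I \<union> ?J) law"
    by (rule L.distr_merge) auto
  finally show ?thesis unfolding IJ .
qed

text \<open>Both \<open>j\<close> and \<open>n\<close> lie in the second block, so the transposition
  preserves the family \<open>law\<close>, and reindexing the product measure leaves it
  unchanged.\<close>

lemma distr_row_swap:
  assumes j: "j \<in> {s + 1..n}"
  shows "distr M (PiM {1..n} (\<lambda>_. borel)) (\<lambda>\<omega>. \<lambda>i\<in>{1..n}. X n (Transposition.transpose j n i) \<omega>) =
    distr M (PiM {1..n} (\<lambda>_. borel)) row"
proof -
  let ?\<sigma> = "Transposition.transpose j n" and ?P = "PiM {1..n} (\<lambda>_. borel :: real measure)"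
  have \<sigma>: "?\<sigma> permutes {1..n}" using j sn by (intro permutes_swap_id) auto
  have in\<sigma>: "?\<sigma> i \<in> {1..n}" if "i \<in> {1..n}" for i
    using permutes_in_image[OF \<sigma>] that by blast
  have law\<sigma>: "law (?\<sigma> i) = law i" for i
    using j sn by (auto simp: law_def Transposition.transpose_def)
  have m: "(\<lambda>x. \<lambda>i\<in>{1..n}. x (?\<sigma> i)) \<in> measurable ?P ?P"
    using in\<sigma> by (intro measurable_restrict measurable_component_singleton) auto
  have "(\<lambda>\<omega>. \<lambda>i\<in>{1..n}. X n (?\<sigma> i) \<omega>) = (\<lambda>x. \<lambda>i\<in>{1..n}. x (?\<sigma> i)) \<circ> row"
    using in\<sigma> by (auto simp: row_def fun_eq_iff)
  then have "distr M ?P (\<lambda>\<omega>. \<lambda>i\<in>{1..n}. X n (?\<sigma> i) \<omega>) = distr (distr M ?P row) ?P (\<lambda>x. \<lambda>i\<in>{1..n}. x (?\<sigma> i))"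
    by (simp only: distr_distr[OF m measurable_row])
  also have "\<dots> = distr (PiM {1..n} law) (PiM {1..n} law) (\<lambda>x. \<lambda>i\<in>{1..n}. x (?\<sigma> i))"
    unfolding distr_row by (intro distr_cong sets_PiM_cong) auto
  also have "\<dots> = PiM {1..n} law"
    using distr_PiM_reindex[of "{1..n}" law ?\<sigma> "{1..n}"] prob_space_law permutes_inj_on[OF \<sigma>] in\<sigma>
    by (auto simp: law\<sigma>)
  finally show ?thesis unfolding distr_row .
qed

lemma space_G [simp]: "space G = space M"
  by (simp add: row_algebra_def)

lemma subalgebra_G: "subalgebra M G"
  unfolding subalgebra_def row_algebra_def
  using measurable_order_stat[of n "X n" M]
  by (auto simp: sets_vimage_algebra2 measurable_def space_PiM)

sublocale finite_measure_subalgebra M G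
  by unfold_locales (rule subalgebra_G)

text \<open>A set of \<open>G\<close> is a preimage under the order statistics, which do not notice
  the transposition. Transposing therefore acts on \<psi> alone, while the law of the row stays the
  same.\<close>

lemma integral_G_swap:
  assumes j: "j \<in> {s + 1..n}" and A: "A \<in> sets G"
    and \<psi>[measurable]: "(\<psi> :: _ \<Rightarrow> real) \<in> borel_measurable (PiM {1..n} (\<lambda>_. borel))"
  shows "(\<integral>\<omega>\<in>A. \<psi> (row \<omega>) \<partial>M) = (\<integral>\<omega>\<in>A. \<psi> (\<lambda>i\<in>{1..n}. X n (Transposition.transpose j n i) \<omega>) \<partial>M)"
proof -
  let ?\<sigma> = "Transposition.transpose j n" and ?P = "PiM {1..n} (\<lambda>_. borel :: real measure)"
  let ?os = "\<lambda>x. \<lambda>k\<in>{1..n}. order_stat n x k"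
  let ?rs = "\<lambda>\<omega>. \<lambda>i\<in>{1..n}. X n (?\<sigma> i) \<omega>"
  have \<sigma>: "?\<sigma> permutes {1..n}" using j sn by (intro permutes_swap_id) auto
  have in\<sigma>: "?\<sigma> i \<in> {1..n}" if "i \<in> {1..n}" for i
    using permutes_in_image[OF \<sigma>] that by blast
  have rs[measurable]: "?rs \<in> measurable M ?P"
    using in\<sigma> by (intro measurable_restrict measurable_entry)
  have os[measurable]: "?os \<in> measurable ?P ?P"
    using measurable_order_stat[of n "\<lambda>i x. x i" ?P] by simp
  have os_cong: "?os (restrict x {1..n}) = ?os x" for x
    by (auto simp: order_stat_def fun_eq_iff cong: map_cong simp del: upt_Suc
        intro!: arg_cong[of _ _ "\<lambda>l. sort l ! _"])
  obtain B where B: "B \<in> sets ?P" "A = (\<lambda>\<omega>. ?os (\<lambda>i. X n i \<omega>)) -` B \<inter> space M"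
    using A unfolding row_algebra_def
    by (subst (asm) sets_vimage_algebra2) (use measurable_order_stat[of n "X n" M] in \<open>auto simp: measurable_def\<close>)
  note B(1)[measurable]
  have 1: "indicator A \<omega> = (indicator B (?os (row \<omega>)) :: real)" if "\<omega> \<in> space M" for \<omega>
    using that unfolding row_def os_cong B(2) by (auto simp: indicator_def)
  have 2: "?os (?rs \<omega>) = ?os (row \<omega>)" for \<omega>
    unfolding row_def os_cong using order_stat_permute[OF \<sigma>, of "\<lambda>i. X n i \<omega>"] by (simp add: fun_eq_iff)
  have "(\<integral>\<omega>\<in>A. \<psi> (row \<omega>) \<partial>M) = (\<integral>\<omega>. indicator B (?os (row \<omega>)) * \<psi> (row \<omega>) \<partial>M)"
    unfolding set_lebesgue_integral_def by (intro Bochner_Integration.integral_cong) (auto simp: 1)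
  also have "\<dots> = (\<integral>x. indicator B (?os x) * \<psi> x \<partial>distr M ?P row)"
    by (subst integral_distr, measurable)
  also have "\<dots> = (\<integral>x. indicator B (?os x) * \<psi> x \<partial>distr M ?P ?rs)"
    unfolding distr_row_swap[OF j] ..
  also have "\<dots> = (\<integral>\<omega>. indicator B (?os (?rs \<omega>)) * \<psi> (?rs \<omega>) \<partial>M)"
    by (subst integral_distr, measurable)
  also have "\<dots> = (\<integral>\<omega>\<in>A. \<psi> (?rs \<omega>) \<partial>M)"
    unfolding set_lebesgue_integral_def 2 by (intro Bochner_Integration.integral_cong) (auto simp: 1)
  finally show ?thesis .
qed

text \<open>Given the unordered row, the last entry is exchangeable with every other entry drawn from \<open>Q\<close>,
  so conditional probabilities of events about its rank are conditional means of averages over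
  the whole \<open>Q\<close> block.\<close>

lemma cond_exp_rank_eq_average:
  fixes rel :: "real \<Rightarrow> real \<Rightarrow> bool" and x :: real
  assumes rel[measurable]: "Measurable.pred (borel \<Otimes>\<^sub>M borel) (\<lambda>(a, b). rel a b)"
  defines "c \<equiv> \<lambda>j \<omega>. \<Sum>i=1..n. of_bool (rel (X n i \<omega>) (X n j \<omega>)) :: real"
  shows "AE \<omega> in M. real_cond_exp M G (\<lambda>\<omega>. of_bool (c n \<omega> \<le> x)) \<omega> =
    real_cond_exp M G (\<lambda>\<omega>. (\<Sum>j=s+1..n. of_bool (c j \<omega> \<le> x)) / real (n - s)) \<omega>"
\<comment> \<open>It suffices to compare integrals over sets of \<open>G\<close>. The block average
  need not be measurable with respect to \<open>G\<close>, so its conditional expectation is the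
  candidate.\<close>
proof (rule real_cond_exp_charact)
  have [measurable]: "c j \<in> borel_measurable M" if "j \<in> {1..n}" for j
    unfolding c_def using that by measurable
  have int: "integrable M (\<lambda>\<omega>. of_bool (c j \<omega> \<le> x) :: real)" if "j \<in> {1..n}" for j
    by (intro integrable_const_bound[where B = 1]) (use that in auto)
  show "integrable M (\<lambda>\<omega>. of_bool (c n \<omega> \<le> x) :: real)"
    using int sn by auto
  have int_avg: "integrable M (\<lambda>\<omega>. (\<Sum>j=s+1..n. of_bool (c j \<omega> \<le> x)) / real (n - s))"
    using int by (intro integrable_divide Bochner_Integration.integrable_sum) auto
  then show "integrable M (real_cond_exp M G (\<lambda>\<omega>. (\<Sum>j=s+1..n. of_bool (c j \<omega> \<le> x)) / real (n - s)))"
    by (rule real_cond_exp_int)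
  fix A assume A: "A \<in> sets G"
  then have AM[measurable]: "A \<in> sets M" using subalgebra_G by (auto simp: subalgebra_def)
  \<comment> \<open>\<psi> reads the rank of coordinate \<open>n\<close>. On the transposed row this
    coordinate carries entry \<open>j\<close>, and the sum over all \<open>i\<close> is only
    reordered, so the value is the event about the rank of entry \<open>j\<close>.\<close>
  define \<psi> :: "(nat \<Rightarrow> real) \<Rightarrow> real" where
    "\<psi> y = of_bool ((\<Sum>i=1..n. of_bool (rel (y i) (y n))) \<le> x)" for y
  have \<psi>_meas: "\<psi> \<in> borel_measurable (PiM {1..n} (\<lambda>_. borel))"
  proof -
    have [measurable]: "n \<in> {1..n}" using sn by auto
    show ?thesis unfolding \<psi>_def by measurable
  qed
  have swap: "(\<integral>\<omega>\<in>A. of_bool (c n \<omega> \<le> x) \<partial>M) = (\<integral>\<omega>\<in>A. (of_bool (c j \<omega> \<le> x) :: real) \<partial>M)" if j: "j \<in> {s+1..n}" for j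
  proof -
    have \<sigma>: "Transposition.transpose j n permutes {1..n}" using j sn by (intro permutes_swap_id) auto
    have "\<psi> (row \<omega>) = of_bool (c n \<omega> \<le> x)" for \<omega>
      using sn by (simp add: \<psi>_def row_def c_def)
    moreover have "\<psi> (\<lambda>i\<in>{1..n}. X n (Transposition.transpose j n i) \<omega>) = of_bool (c j \<omega> \<le> x)" for \<omega>
    proof -
      have "(\<Sum>i=1..n. of_bool (rel (X n (Transposition.transpose j n i) \<omega>) (X n j \<omega>)) :: real) = c j \<omega>"
        unfolding c_def by (rule sum.permute[OF \<sigma>, symmetric, unfolded comp_def])
      then show ?thesis
        using sn by (simp add: \<psi>_def)
    qed
    ultimately show ?thesis
      using integral_G_swap[OF j A \<psi>_meas] by simp
  qed
  have "(\<integral>\<omega>\<in>A. real_cond_exp M G (\<lambda>\<omega>. (\<Sum>j=s+1..n. of_bool (c j \<omega> \<le> x)) / real (n - s)) \<omega> \<partial>M)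
      = (\<integral>\<omega>\<in>A. (\<Sum>j=s+1..n. of_bool (c j \<omega> \<le> x)) / real (n - s) \<partial>M)"
    by (rule real_cond_exp_intA[OF int_avg A, symmetric])
  also have "\<dots> = (\<Sum>j=s+1..n. (\<integral>\<omega>\<in>A. of_bool (c j \<omega> \<le> x) \<partial>M)) / real (n - s)"
  proof -
    have "integrable M (\<lambda>\<omega>. indicator A \<omega> * of_bool (c j \<omega> \<le> x) :: real)" if "j \<in> {s+1..n}" for j
      using integrable_mult_indicator[OF AM int[of j]] that by auto
    then have "(\<integral>\<omega>. (\<Sum>j=s+1..n. indicator A \<omega> * of_bool (c j \<omega> \<le> x)) \<partial>M) =
        (\<Sum>j=s+1..n. (\<integral>\<omega>. indicator A \<omega> * of_bool (c j \<omega> \<le> x) \<partial>M :: real))"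
      by (rule Bochner_Integration.integral_sum)
    then show ?thesis
      unfolding set_lebesgue_integral_def real_scaleR_def times_divide_eq_right sum_distrib_left
        integral_divide_zero by (simp only:)
  qed
  also have "\<dots> = (\<Sum>j=s+1..n. (\<integral>\<omega>\<in>A. of_bool (c n \<omega> \<le> x) \<partial>M)) / real (n - s)"
    using swap by (intro arg_cong2[of _ _ _ _ "(/)"] sum.cong) auto
  also have "\<dots> = (\<integral>\<omega>\<in>A. of_bool (c n \<omega> \<le> x) \<partial>M)"
    using sn by simp
  finally show "(\<integral>\<omega>\<in>A. of_bool (c n \<omega> \<le> x) \<partial>M) =
    (\<integral>\<omega>\<in>A. real_cond_exp M G (\<lambda>\<omega>. (\<Sum>j=s+1..n. of_bool (c j \<omega> \<le> x)) / real (n - s)) \<omega> \<partial>M)" ..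
qed measurable

end

section \<open>Deviation of the ranks\<close>

locale mixture_cdf = R: real_distribution R + Q: real_distribution Q for R Q :: "real measure" +
  fixes c :: real
  assumes c0: "0 < c" and c1: "c < 1"
    and cont_R: "\<And>x. isCont (cdf R) x" and cont_Q: "\<And>x. isCont (cdf Q) x"
begin

definition F :: "real \<Rightarrow> real" where
  "F x = c * cdf R x + (1 - c) * cdf Q x"

text \<open>\<open>HR\<close> and \<open>HQ\<close> are the distribution functions of
  \<open>F Z\<close> for \<open>Z\<close> drawn from \<open>R\<close> and from
  \<open>Q\<close>.\<close>

definition HR :: "real \<Rightarrow> real" where "HR u = measure R {x. F x \<le> u}"
definition HQ :: "real \<Rightarrow> real" where "HQ u = measure Q {x. F x \<le> u}"

text \<open>A common Lipschitz constant for \<open>HR\<close> and \<open>HQ\<close>; the sum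
  dominates both slopes and 1.\<close>

definition L :: real where "L = 1 / c + 1 / (1 - c)"

lemma F_mono: "x \<le> y \<Longrightarrow> F x \<le> F y"
  unfolding F_def using c0 c1
  by (intro add_mono mult_left_mono R.cdf_nondecreasing Q.cdf_nondecreasing) auto

lemma continuous_F: "continuous_on A F"
  unfolding F_def[abs_def]
  by (intro continuous_intros continuous_at_imp_continuous_on ballI cont_R cont_Q)

lemma measurable_F [measurable]: "F \<in> borel_measurable borel"
  by (rule borel_measurable_continuous_onI[OF continuous_F])

lemma F_bounds: "0 \<le> F x" "F x \<le> 1"
proof -
  show "0 \<le> F x"
    unfolding F_def using c0 c1 R.cdf_nonneg Q.cdf_nonneg by (intro add_nonneg_nonneg mult_nonneg_nonneg) auto
  have "F x \<le> c * 1 + (1 - c) * 1"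
    unfolding F_def using c0 c1
    by (intro add_mono mult_left_mono R.cdf_bounded_prob Q.cdf_bounded_prob) auto
  then show "F x \<le> 1" by simp
qed

lemma F_at_top: "(F \<longlongrightarrow> 1) at_top" and F_at_bot: "(F \<longlongrightarrow> 0) at_bot"
proof -
  have "(F \<longlongrightarrow> c * 1 + (1 - c) * 1) at_top"
    unfolding F_def[abs_def] by (intro tendsto_intros R.cdf_lim_at_top_prob Q.cdf_lim_at_top_prob)
  then show "(F \<longlongrightarrow> 1) at_top" by simp
  have "(F \<longlongrightarrow> c * 0 + (1 - c) * 0) at_bot"
    unfolding F_def[abs_def] by (intro tendsto_intros R.cdf_lim_at_bot Q.cdf_lim_at_bot)
  then show "(F \<longlongrightarrow> 0) at_bot" by simp
qed

text \<open>The probability integral transform: if \<open>Z\<close> follows the mixture, then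
  \<open>F Z\<close> is uniform because \<open>F\<close> is continuous. For \<open>u\<close> in
  [0,1) a nonempty level set is a half-line \<open>{..m}\<close> with \<open>F m = u\<close>, and
  its mixture mass is \<open>F m\<close>. Clamping \<open>u\<close> covers all real
  arguments.\<close>

lemma level_sets: "c * HR u + (1 - c) * HQ u = max 0 (min 1 u)"
proof -
  consider "u < 0" | "1 \<le> u" | "0 \<le> u" "u < 1" by linarith
  then show ?thesis
  proof cases
    case 1
    then have "\<not> F x \<le> u" for x using F_bounds(1)[of x] by linarith
    then have "{x. F x \<le> u} = {}" by simp
    then show ?thesis using 1 by (simp add: HR_def HQ_def)
  next
    case 2
    then have "F x \<le> u" for x using F_bounds(2)[of x] by linarith
    then have "{x. F x \<le> u} = UNIV" by simp
    then show ?thesis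
      using 2 R.prob_space Q.prob_space by (simp add: HR_def HQ_def)
  next
    case 3
    let ?S = "{x. F x \<le> u}"
    show ?thesis
    proof (cases "?S = {}")
      \<comment> \<open>Since \<open>F\<close> tends to 0 on the left, an empty level set forces
        \<open>u = 0\<close>, where both sides vanish.\<close>
      case True
      have "u \<le> 0"
      proof (rule ccontr)
        assume "\<not> u \<le> 0"
        then have "eventually (\<lambda>x. F x < u) at_bot"
          using F_at_bot by (intro order_tendstoD(2)) auto
        then obtain x where "F x < u" by (auto simp: eventually_at_bot_linorder)
        then have "x \<in> ?S" by simp
        with True show False by blast
      qed
      with 3 show ?thesis unfolding HR_def HQ_def True by simp
    next
      case False
      have "eventually (\<lambda>x. u < F x) at_top"
        using F_at_top 3 by (intro order_tendstoD(1)) auto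
      then obtain B where B: "\<And>x. B \<le> x \<Longrightarrow> u < F x" by (auto simp: eventually_at_top_linorder)
      have bdd: "bdd_above ?S"
      proof (rule bdd_aboveI)
        fix x assume "x \<in> ?S"
        then show "x \<le> B" using B[of x] by (cases "B \<le> x") auto
      qed
      have closed: "closed ?S"
        by (intro closed_Collect_le continuous_F continuous_on_const)
      define m where "m = Sup ?S"
      have mS: "F m \<le> u"
        using closed_contains_Sup[OF False bdd closed] by (simp add: m_def)
      have above: "u < F y" if "m < y" for y
        using cSup_upper[OF _ bdd, of y] that unfolding m_def by fastforce
      \<comment> \<open>To the right of the supremum \<open>m\<close> all values exceed
        \<open>u\<close>, so continuity gives \<open>u \<le> F m\<close>, the missing half of
        \<open>F m = u\<close>.\<close>
      have "(F \<longlongrightarrow> F m) (at_right m)"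
        using continuous_F[of UNIV] by (auto simp: continuous_on_def intro: tendsto_within_subset)
      then have "u \<le> F m"
        by (rule tendsto_lowerbound)
           (auto simp: eventually_at_filter intro!: always_eventually less_imp_le above)
      with mS have Fm: "F m = u" by simp
      have "?S = {..m}"
      proof (intro equalityI subsetI)
        fix x assume "x \<in> ?S"
        then show "x \<in> {..m}" using above[of x] by fastforce
      next
        fix x assume "x \<in> {..m}"
        then show "x \<in> ?S" using F_mono[of x m] mS by simp
      qed
      then show ?thesis
        using Fm 3 by (simp add: HR_def HQ_def F_def cdf_def)
    qed
  qed
qed

lemma HR_mono: "a \<le> b \<Longrightarrow> HR a \<le> HR b"
  unfolding HR_def by (intro R.finite_measure_mono) auto

lemma HQ_mono: "a \<le> b \<Longrightarrow> HQ a \<le> HQ b"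
  unfolding HQ_def by (intro Q.finite_measure_mono) auto

lemma L_ge: "1 / c \<le> L" "1 / (1 - c) \<le> L" "1 \<le> L"
proof -
  have "1 \<le> 1 / c" "0 \<le> 1 / c" "0 \<le> 1 / (1 - c)" using c0 c1 by auto
  then show "1 / c \<le> L" "1 / (1 - c) \<le> L" "1 \<le> L" unfolding L_def by linarith+
qed

text \<open>The slopes are bounded because \<open>c R\<close> and \<open>(1 - c) Q\<close> are both dominated by the mixture, whose
  level sets \<open>{x. F x \<le> u}\<close> have mass \<open>u\<close>.\<close>

lemma HR_Lipschitz:
  assumes "a \<le> b" shows "HR b - HR a \<le> L * (b - a)"
proof -
  have "(1 - c) * HQ a \<le> (1 - c) * HQ b" using HQ_mono[OF assms] c1 by simp
  then have "c * (HR b - HR a) \<le> b - a"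
    using level_sets[of a] level_sets[of b] assms by (simp add: algebra_simps)
  then have "HR b - HR a \<le> 1 / c * (b - a)" using c0 by (simp add: field_simps)
  also have "\<dots> \<le> L * (b - a)" using L_ge assms by (intro mult_right_mono) auto
  finally show ?thesis .
qed

lemma HQ_Lipschitz:
  assumes "a \<le> b" shows "HQ b - HQ a \<le> L * (b - a)"
proof -
  have "c * HR a \<le> c * HR b" using HR_mono[OF assms] c0 by simp
  then have "(1 - c) * (HQ b - HQ a) \<le> b - a"
    using level_sets[of a] level_sets[of b] assms by (simp add: algebra_simps)
  then have "HQ b - HQ a \<le> 1 / (1 - c) * (b - a)" using c1 by (simp add: field_simps)
  also have "\<dots> \<le> L * (b - a)" using L_ge assms by (intro mult_right_mono) auto
  finally show ?thesis .
qed

end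

section \<open>Ranks in a row compared with the mixture distribution function\<close>

locale two_sample_mixture = two_sample_row M R Q X s n + mixture_cdf R Q c
  for M :: "'a measure" and R Q X s n c +
  assumes s_le: "real s \<le> c * real n" and s_ge: "c * real n \<le> real s + 1"
begin

text \<open>Ranks of the transformed entries. \<open>F\<close> is monotone but may be flat, so
  comparing after \<open>F\<close> can only lower the strict rank and raise the weak one; the two
  enclose \<open>n\<close> times the p-value for every tie-breaking value in [0,1].\<close>

definition rank_lt :: "nat \<Rightarrow> 'a \<Rightarrow> real" where
  "rank_lt j \<omega> = (\<Sum>i=1..n. of_bool (F (X n i \<omega>) < F (X n j \<omega>)))"

definition rank_le :: "nat \<Rightarrow> 'a \<Rightarrow> real" where
  "rank_le j \<omega> = (\<Sum>i=1..n. of_bool (F (X n i \<omega>) \<le> F (X n j \<omega>)))"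

text \<open>The rank of an entry with transformed value \<open>U\<close> is close to
  \<open>n * U\<close>, by the empirical process bound for both blocks. Hence the entries of the
  second block with rank at most \<open>n * e\<close> are, up to a small shift of \<open>e\<close>,
  those with \<open>U \<le> e\<close>. A second use of the bound for that block, with
  \<open>HQ\<close> Lipschitz, compares their proportion with \<open>HQ e\<close>.\<close>

lemma block_average_bounds:
  "\<exists>W. integrable M W \<and> (\<forall>\<omega>. 0 \<le> W \<omega>) \<and> expectation W \<le> L * (81 * L\<^sup>2 + 2) \<and>
    (\<forall>\<omega>\<in>space M. \<forall>e.
      (\<Sum>j=s+1..n. of_bool (rank_lt j \<omega> \<le> real n * e)) / real (n - s) \<le> HQ e + W \<omega> / sqrt n \<and>
      HQ e - W \<omega> / sqrt n \<le> (\<Sum>j=s+1..n. of_bool (rank_le j \<omega> \<le> real n * e)) / real (n - s))"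
proof -
  define U where "U i \<omega> = F (X n i \<omega>)" for i \<omega>
  have U_law: "prob {\<omega> \<in> space M. U i \<omega> \<le> u} = measure (law i) {x. F x \<le> u}" if "i \<in> {1..n}" for i u
  proof -
    have "measure (law i) {x. F x \<le> u} = prob (X n i -` {x. F x \<le> u} \<inter> space M)"
      unfolding distr_entry[OF that, symmetric] using that by (intro measure_distr) auto
    also have "X n i -` {x. F x \<le> u} \<inter> space M = {\<omega> \<in> space M. U i \<omega> \<le> u}"
      by (auto simp: U_def)
    finally show ?thesis ..
  qed
  obtain BR where BR: "integrable M BR" "\<And>\<omega>. 0 \<le> BR \<omega>" "expectation BR \<le> 27 * L\<^sup>2"
    "\<And>\<omega> u. \<omega> \<in> space M \<Longrightarrow>
      \<bar>(\<Sum>i\<in>{1..s}. of_bool (U i \<omega> \<le> u)) - card {1..s} * HR u\<bar> \<le> sqrt (card {1..s}) * BR \<omega>"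
  proof (rule empirical_process_bound[of "{1..s}" U HR L])
    show "indep_vars (\<lambda>_. borel) U {1..s}"
      unfolding U_def using iid_R by (intro indep_vars_compose2[where Y = "\<lambda>_. F"]) (auto simp: iid_def)
    show "prob {\<omega> \<in> space M. U i \<omega> \<le> u} = HR u" if "i \<in> {1..s}" for i u
      using U_law[of i u] that sn by (simp add: law_def HR_def)
  qed (use L_ge HR_Lipschitz F_bounds in \<open>auto simp: U_def\<close>)
  obtain BQ where BQ: "integrable M BQ" "\<And>\<omega>. 0 \<le> BQ \<omega>" "expectation BQ \<le> 27 * L\<^sup>2"
    "\<And>\<omega> u. \<omega> \<in> space M \<Longrightarrow>
      \<bar>(\<Sum>i\<in>{s+1..n}. of_bool (U i \<omega> \<le> u)) - card {s+1..n} * HQ u\<bar> \<le> sqrt (card {s+1..n}) * BQ \<omega>"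
  proof (rule empirical_process_bound[of "{s+1..n}" U HQ L])
    show "indep_vars (\<lambda>_. borel) U {s+1..n}"
      unfolding U_def using iid_Q by (intro indep_vars_compose2[where Y = "\<lambda>_. F"]) (auto simp: iid_def)
    show "prob {\<omega> \<in> space M. U i \<omega> \<le> u} = HQ u" if "i \<in> {s+1..n}" for i u
      using U_law[of i u] that by (simp add: law_def HQ_def)
  qed (use L_ge HQ_Lipschitz F_bounds in \<open>auto simp: U_def\<close>)
  \<comment> \<open>\<open>BR + BQ + 2\<close> comes from the rank error, amplified by the slope of
    \<open>HQ\<close>; the second \<open>BQ\<close> is the sampling error of the \<open>Q\<close>
    block, where \<open>L\<close> converts \<open>1 / sqrt m\<close> into
    \<open>1 / sqrt n\<close>.\<close>
  define W where "W \<omega> = L * (BR \<omega> + 2 * BQ \<omega> + 2)" for \<omega>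
  define m where "m = n - s"
  have m: "real m = real n - real s" "0 < real m" "0 < real n"
    using sn by (auto simp: m_def)
  have Lm: "real n \<le> L * real m"
  proof -
    have "(1 - c) * real n \<le> real m" using s_le m by (simp add: algebra_simps)
    then have "real n \<le> 1 / (1 - c) * real m" using c1 by (simp add: field_simps)
    also have "\<dots> \<le> L * real m" using L_ge by (intro mult_right_mono) auto
    finally show ?thesis .
  qed
  have sqrt_m: "sqrt n \<le> L * sqrt m"
  proof -
    have "L * real m \<le> L * (L * real m)"
      using L_ge(3) mult_right_mono[of 1 L "L * real m"] by simp
    then have "real n \<le> L\<^sup>2 * real m"
      using Lm by (simp add: power2_eq_square)
    then have "sqrt n \<le> sqrt (L\<^sup>2 * real m)" by simp
    then show ?thesis using L_ge(3) by (simp add: real_sqrt_mult)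
  qed
  have pathwise:
    "(\<Sum>j=s+1..n. of_bool (rank_lt j \<omega> \<le> real n * e)) / real m \<le> HQ e + W \<omega> / sqrt n"
    "HQ e - W \<omega> / sqrt n \<le> (\<Sum>j=s+1..n. of_bool (rank_le j \<omega> \<le> real n * e)) / real m"
    if \<omega>: "\<omega> \<in> space M" for \<omega> e
  proof -
    define CR where "CR u = (\<Sum>i=1..s. of_bool (U i \<omega> \<le> u) :: real)" for u
    define CQ where "CQ u = (\<Sum>i=s+1..n. of_bool (U i \<omega> \<le> u) :: real)" for u
    define C where "C u = (\<Sum>i=1..n. of_bool (U i \<omega> \<le> u) :: real)" for u
    define \<Delta> where "\<Delta> = sqrt n * (BR \<omega> + BQ \<omega> + 2)"
    have C_split: "C u = CR u + CQ u" for u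
    proof -
      have "{1..n} = {1..s} \<union> {s+1..n}" using sn by auto
      moreover have "(\<Sum>i\<in>{1..s} \<union> {s+1..n}. of_bool (U i \<omega> \<le> u) :: real) =
          (\<Sum>i=1..s. of_bool (U i \<omega> \<le> u)) + (\<Sum>i=s+1..n. of_bool (U i \<omega> \<le> u))"
        by (rule sum.union_disjoint) auto
      ultimately show ?thesis by (simp only: C_def CR_def CQ_def)
    qed
    have devR: "\<bar>CR u - real s * HR u\<bar> \<le> sqrt s * BR \<omega>" for u
      using BR(4)[OF \<omega>, of u] by (simp add: CR_def)
    have devQ: "\<bar>CQ u - real m * HQ u\<bar> \<le> sqrt m * BQ \<omega>" for u
      using BQ(4)[OF \<omega>, of u] by (simp add: CQ_def m_def)
    have \<Delta>0: "0 \<le> \<Delta>" unfolding \<Delta>_def using BR(2) BQ(2) by (intro mult_nonneg_nonneg add_nonneg_nonneg) auto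
    \<comment> \<open>The mean of \<open>C u\<close> misses \<open>n * u\<close> by
      \<open>(s - c * n) * (HR u - HQ u)\<close>, because \<open>s\<close> is \<open>c * n\<close>
      only up to rounding. This is at most 1 in absolute value and is absorbed by the summand
      \<open>2 * sqrt n\<close> of \<Delta>.\<close>
    have dev: "\<bar>C u - real n * u\<bar> \<le> \<Delta>" if u: "0 \<le> u" "u \<le> 1" for u
    proof -
      have "c * HR u + (1 - c) * HQ u = u" using level_sets[of u] u by simp
      then have "real n * u = real n * (c * HR u + (1 - c) * HQ u)" by simp
      then have "real s * HR u + real m * HQ u - real n * u = (real s - c * real n) * (HR u - HQ u)"
        unfolding m(1) by (simp add: algebra_simps)
      moreover have "\<bar>(real s - c * real n) * (HR u - HQ u)\<bar> \<le> 1 * 1"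
        unfolding abs_mult
      proof (intro mult_mono)
        show "\<bar>HR u - HQ u\<bar> \<le> 1"
          unfolding HR_def HQ_def using R.prob_le_1[of "{x. F x \<le> u}"] Q.prob_le_1[of "{x. F x \<le> u}"]
            measure_nonneg[of R "{x. F x \<le> u}"] measure_nonneg[of Q "{x. F x \<le> u}"] by linarith
      qed (use s_le s_ge in auto)
      moreover have "sqrt s * BR \<omega> \<le> sqrt n * BR \<omega>" "sqrt m * BQ \<omega> \<le> sqrt n * BQ \<omega>"
        using sn BR(2) BQ(2) by (auto intro!: mult_right_mono simp: m_def)
      moreover have "1 \<le> sqrt n" using sn by simp
      moreover have "\<Delta> = sqrt n * BR \<omega> + sqrt n * BQ \<omega> + 2 * sqrt n"
        by (simp add: \<Delta>_def algebra_simps)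
      ultimately show ?thesis
        using devR[of u] devQ[of u] unfolding C_split by linarith
    qed
    have U01: "0 \<le> U i \<omega>" "U i \<omega> \<le> 1" for i using F_bounds by (auto simp: U_def)
    define d where "d = \<Delta> / real n"
    have d: "d = (BR \<omega> + BQ \<omega> + 2) / sqrt n" "0 \<le> d"
    proof -
      have "d = sqrt n * (BR \<omega> + BQ \<omega> + 2) / (sqrt n * sqrt n)"
        unfolding d_def \<Delta>_def by simp
      also have "\<dots> = (BR \<omega> + BQ \<omega> + 2) / sqrt n"
        using m(3) by (simp only: mult_divide_mult_cancel_left_if real_sqrt_eq_0_iff if_False less_imp_neq[THEN not_sym])
      finally show "d = (BR \<omega> + BQ \<omega> + 2) / sqrt n" .
      show "0 \<le> d" using \<Delta>0 by (simp add: d_def)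
    qed
    have nd: "real n * d = \<Delta>" using m(3) by (simp add: d_def)
    have err: "L * d + BQ \<omega> / sqrt m \<le> W \<omega> / sqrt n"
    proof -
      have "BQ \<omega> * sqrt n \<le> BQ \<omega> * (L * sqrt m)" using sqrt_m BQ(2) by (intro mult_left_mono) auto
      then have "BQ \<omega> / sqrt m \<le> L * BQ \<omega> / sqrt n" using m(2,3) by (simp add: field_simps)
      moreover have "L * d = L * (BR \<omega> + BQ \<omega> + 2) / sqrt n" by (simp add: d(1))
      ultimately have "L * d + BQ \<omega> / sqrt m \<le> L * (BR \<omega> + BQ \<omega> + 2) / sqrt n + L * BQ \<omega> / sqrt n"
        by linarith
      also have "\<dots> = W \<omega> / sqrt n" by (simp add: W_def add_divide_distrib[symmetric] algebra_simps)
      finally show ?thesis .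
    qed
    have mm: "sqrt m * BQ \<omega> = real m * (BQ \<omega> / sqrt m)"
    proof -
      have "sqrt m * sqrt m = real m" by simp
      then have "real m * (BQ \<omega> / sqrt m) = sqrt m * (sqrt m * BQ \<omega> / sqrt m)"
        by (metis mult.assoc times_divide_eq_right)
      also have "sqrt m * BQ \<omega> / sqrt m = BQ \<omega>" using m(2) by simp
      finally show ?thesis ..
    qed
    have rank_le_C: "rank_le j \<omega> = C (U j \<omega>)" for j
      by (simp add: rank_le_def C_def U_def)
    have lower: "CQ (e - d) \<le> (\<Sum>j=s+1..n. of_bool (rank_le j \<omega> \<le> real n * e))"
      unfolding CQ_def
    proof (intro sum_mono)
      fix j
      have "C (U j \<omega>) \<le> real n * e" if "U j \<omega> \<le> e - d"
      proof -
        have "C (U j \<omega>) \<le> real n * U j \<omega> + real n * d" using dev[OF U01, of j] nd by linarith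
        also have "\<dots> = real n * (U j \<omega> + d)" by (simp add: distrib_left)
        also have "\<dots> \<le> real n * e" using that by (intro mult_left_mono) auto
        finally show ?thesis .
      qed
      then show "of_bool (U j \<omega> \<le> e - d) \<le> (of_bool (rank_le j \<omega> \<le> real n * e) :: real)"
        by (auto simp: rank_le_C)
    qed
    have upper: "(\<Sum>j=s+1..n. of_bool (rank_lt j \<omega> \<le> real n * e)) \<le> CQ (e + d)"
      unfolding CQ_def
    proof (intro sum_mono)
      fix j
      have "U j \<omega> \<le> e + d" if j: "rank_lt j \<omega> \<le> real n * e"
      \<comment> \<open>\<open>rank_lt\<close> excludes entries equal to \<open>U j\<close>, so it
        is not a value of \<open>C\<close>. It dominates \<open>C v\<close> for every
        \<open>v\<close> below \<open>U j\<close>, and \<open>v\<close> may then approach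
        \<open>U j\<close>. For negative \<open>v\<close>, outside the range of \<open>dev\<close>,
        the bound is trivial.\<close>
      proof (rule dense_le)
        fix v assume v: "v < U j \<omega>"
        have "C v \<le> rank_lt j \<omega>"
          unfolding C_def rank_lt_def U_def[symmetric] by (intro sum_mono) (use v in auto)
        moreover have "real n * v \<le> C v + \<Delta>"
        proof (cases "0 \<le> v")
          case True
          then show ?thesis using dev[of v] v U01(2)[of j] by linarith
        next
          case False
          then have "real n * v \<le> 0" by (simp add: mult_nonneg_nonpos)
          moreover have "0 \<le> C v" unfolding C_def by (intro sum_nonneg) auto
          ultimately show ?thesis using \<Delta>0 by linarith
        qed
        ultimately have "real n * v \<le> real n * (e + d)" using j nd by (simp add: distrib_left)
        then show "v \<le> e + d" using m(3) by simp
      qed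
      then show "of_bool (rank_lt j \<omega> \<le> real n * e) \<le> (of_bool (U j \<omega> \<le> e + d) :: real)"
        by auto
    qed
    have "CQ (e + d) \<le> real m * HQ (e + d) + sqrt m * BQ \<omega>" using devQ[of "e + d"] by linarith
    also have "\<dots> = real m * (HQ (e + d) + BQ \<omega> / sqrt m)" unfolding mm by (simp add: distrib_left)
    also have "\<dots> \<le> real m * (HQ e + W \<omega> / sqrt n)"
      using HQ_Lipschitz[of e "e + d"] d(2) err by (intro mult_left_mono) auto
    finally have "CQ (e + d) \<le> real m * (HQ e + W \<omega> / sqrt n)" .
    with upper show "(\<Sum>j=s+1..n. of_bool (rank_lt j \<omega> \<le> real n * e)) / real m \<le> HQ e + W \<omega> / sqrt n"
      using m(2) by (simp add: divide_le_eq mult.commute)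
    have "real m * (HQ e - W \<omega> / sqrt n) \<le> real m * (HQ (e - d) - BQ \<omega> / sqrt m)"
      using HQ_Lipschitz[of "e - d" e] d(2) err by (intro mult_left_mono) auto
    also have "\<dots> = real m * HQ (e - d) - sqrt m * BQ \<omega>" unfolding mm by (simp add: right_diff_distrib)
    also have "\<dots> \<le> CQ (e - d)" using devQ[of "e - d"] by linarith
    finally have "real m * (HQ e - W \<omega> / sqrt n) \<le> CQ (e - d)" .
    with lower show "HQ e - W \<omega> / sqrt n \<le> (\<Sum>j=s+1..n. of_bool (rank_le j \<omega> \<le> real n * e)) / real m"
      using m(2) by (simp add: le_divide_eq mult.commute)
  qed
  show ?thesis
  proof (intro exI[of _ W] conjI allI ballI)
    show "integrable M W" unfolding W_def using BR(1) BQ(1) by auto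
    show "0 \<le> W \<omega>" for \<omega> unfolding W_def using BR(2) BQ(2) L_ge(3) by (intro mult_nonneg_nonneg add_nonneg_nonneg) auto
    have "expectation W = L * (expectation BR + 2 * expectation BQ + 2)"
      unfolding W_def using BR(1) BQ(1) by (simp add: prob_space)
    also have "\<dots> \<le> L * (81 * L\<^sup>2 + 2)"
      using BR(3) BQ(3) L_ge(3) by (intro mult_left_mono) auto
    finally show "expectation W \<le> L * (81 * L\<^sup>2 + 2)" .
  qed (use pathwise in \<open>simp_all only: m_def\<close>)
qed

end

section \<open>The conditional distribution function\<close>

context two_sample_mixture
begin

text \<open>Ties are weighted by a number in [0,1], so \<open>n * pval\<close> lies between the
  strict and the weak rank of the last entry. The conditional CDF is thereby enclosed between events
  free of \<open>lam\<close>.\<close>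

lemma indicator_pval_bounds:
  assumes "0 \<le> lam n \<omega>" "lam n \<omega> \<le> 1"
  shows "of_bool (rank_le n \<omega> \<le> real n * e) \<le> (indicator {..e} (pval X lam n \<omega>) :: real)"
    and "indicator {..e} (pval X lam n \<omega>) \<le> (of_bool (rank_lt n \<omega> \<le> real n * e) :: real)"
proof -
  let ?lt = "\<Sum>i=1..n. of_bool (X n i \<omega> < X n n \<omega>) :: real"
  let ?eq = "\<Sum>i=1..n. of_bool (X n i \<omega> = X n n \<omega>) :: real"
  have n0: "0 < real n" using sn by simp
  have p: "real n * pval X lam n \<omega> = ?lt + lam n \<omega> * ?eq"
    using n0 by (simp add: pval_def)
  have eq0: "0 \<le> ?eq" by (intro sum_nonneg) auto
  have "rank_lt n \<omega> \<le> ?lt"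
    unfolding rank_lt_def using F_mono by (intro sum_mono) (auto simp: not_less[symmetric])
  moreover have "0 \<le> lam n \<omega> * ?eq" using assms eq0 by simp
  ultimately have 1: "rank_lt n \<omega> \<le> real n * pval X lam n \<omega>" unfolding p by linarith
  have "lam n \<omega> * ?eq \<le> 1 * ?eq" using assms eq0 by (intro mult_right_mono)
  then have "real n * pval X lam n \<omega> \<le> ?lt + ?eq" unfolding p by simp
  also have "\<dots> \<le> rank_le n \<omega>"
    unfolding rank_le_def sum.distrib[symmetric] by (intro sum_mono) (auto simp: F_mono)
  finally have 2: "real n * pval X lam n \<omega> \<le> rank_le n \<omega>" .
  have iff: "real n * pval X lam n \<omega> \<le> real n * e \<longleftrightarrow> pval X lam n \<omega> \<le> e"
    using n0 by simp
  have "rank_le n \<omega> \<le> real n * e \<Longrightarrow> pval X lam n \<omega> \<le> e"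
    unfolding iff[symmetric] using 2 by linarith
  then show "of_bool (rank_le n \<omega> \<le> real n * e) \<le> (indicator {..e} (pval X lam n \<omega>) :: real)"
    by (simp add: indicator_def)
  have "pval X lam n \<omega> \<le> e \<Longrightarrow> rank_lt n \<omega> \<le> real n * e"
    unfolding iff[symmetric] using 1 by linarith
  then show "indicator {..e} (pval X lam n \<omega>) \<le> (of_bool (rank_lt n \<omega> \<le> real n * e) :: real)"
    by (simp add: indicator_def)
qed

text \<open>Conditional expectation is monotone: the enclosing rank events are replaced by block
  averages, and these by \<open>HQ e\<close> with an error that is a multiple of \<open>W\<close>.
  Only \<open>W\<close> remains random under the conditioning.\<close>

lemma cond_cdf_bound:
  assumes lam[measurable]: "lam n \<in> borel_measurable M"
    and lam01: "AE \<omega> in M. 0 \<le> lam n \<omega> \<and> lam n \<omega> \<le> 1"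
    and cdf: "is_cond_cdf M G (pval X lam n) Fn"
  shows "\<exists>Z. integrable M Z \<and> (AE \<omega> in M. 0 \<le> Z \<omega>) \<and> expectation Z \<le> L * (81 * L\<^sup>2 + 2) \<and>
    (AE \<omega> in M. \<forall>e. \<bar>Fn \<omega> e - HQ e\<bar> \<le> Z \<omega> / sqrt n)"
proof -
  obtain W where W: "integrable M W" "\<And>\<omega>. 0 \<le> W \<omega>" "expectation W \<le> L * (81 * L\<^sup>2 + 2)"
    and W_upper: "\<And>\<omega> e. \<omega> \<in> space M \<Longrightarrow>
      (\<Sum>j=s+1..n. of_bool (rank_lt j \<omega> \<le> real n * e)) / real (n - s) \<le> HQ e + W \<omega> / sqrt n"
    and W_lower: "\<And>\<omega> e. \<omega> \<in> space M \<Longrightarrow>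
      HQ e - W \<omega> / sqrt n \<le> (\<Sum>j=s+1..n. of_bool (rank_le j \<omega> \<le> real n * e)) / real (n - s)"
    using block_average_bounds by auto
  obtain K where rcd: "regular_cond_distr M G (pval X lam n) K"
    and "\<forall>\<omega>\<in>space M. \<forall>e. Fn \<omega> e = cdf (K \<omega>) e"
    using cdf unfolding is_cond_cdf_def by blast
  then have Fn: "\<And>\<omega> e. \<omega> \<in> space M \<Longrightarrow> Fn \<omega> e = cdf (K \<omega>) e" by blast
  have K: "K \<in> measurable G (prob_algebra borel)"
    and K_cond: "\<And>A. A \<in> sets borel \<Longrightarrow> AE \<omega> in M.
        measure (K \<omega>) A = real_cond_exp M G (\<lambda>\<omega>'. indicator A (pval X lam n \<omega>')) \<omega>"
    using rcd unfolding regular_cond_distr_def by blast+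
  have nn: "n \<in> {1..n}" using sn by auto
  have rank_meas: "rank_lt j \<in> borel_measurable M" "rank_le j \<in> borel_measurable M" if j: "j \<in> {1..n}" for j
    unfolding rank_lt_def rank_le_def
  proof (safe intro!: borel_measurable_sum)
    fix i assume i: "i \<in> {1..n}"
    note [measurable] = measurable_entry[OF i] measurable_entry[OF j]
    show "(\<lambda>\<omega>. of_bool (F (X n i \<omega>) < F (X n j \<omega>)) :: real) \<in> borel_measurable M" by measurable
    show "(\<lambda>\<omega>. of_bool (F (X n i \<omega>) \<le> F (X n j \<omega>)) :: real) \<in> borel_measurable M" by measurable
  qed
  have p_meas[measurable]: "pval X lam n \<in> borel_measurable M"
    unfolding pval_def
  proof (intro borel_measurable_divide borel_measurable_add borel_measurable_times borel_measurable_sum lam borel_measurable_const)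
    fix i assume i: "i \<in> {1..n}"
    note [measurable] = measurable_entry[OF i] measurable_entry[OF nn]
    show "(\<lambda>\<omega>. of_bool (X n i \<omega> < X n n \<omega>) :: real) \<in> borel_measurable M" by measurable
    show "(\<lambda>\<omega>. of_bool (X n i \<omega> = X n n \<omega>) :: real) \<in> borel_measurable M" by measurable
  qed
  \<comment> \<open>\<open>Z\<close> does not depend on \<open>e\<close> and has the same mean as
    \<open>W\<close>.\<close>
  define Z where "Z = real_cond_exp M G W"
  have Z_int: "integrable M Z" unfolding Z_def using W(1) by (rule real_cond_exp_int)
  have Z_exp: "expectation Z = expectation W" unfolding Z_def using W(1) by (rule real_cond_exp_int)
  have Z_pos: "AE \<omega> in M. 0 \<le> Z \<omega>"
    unfolding Z_def using W by (intro real_cond_exp_pos) auto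
  have int_lt: "integrable M (\<lambda>\<omega>. of_bool (rank_lt j \<omega> \<le> x) :: real)" if "j \<in> {1..n}" for j x
  proof (rule integrable_const_bound[where B = 1])
    note [measurable] = rank_meas[OF that]
    show "(\<lambda>\<omega>. of_bool (rank_lt j \<omega> \<le> x) :: real) \<in> borel_measurable M" by measurable
  qed auto
  have int_le: "integrable M (\<lambda>\<omega>. of_bool (rank_le j \<omega> \<le> x) :: real)" if "j \<in> {1..n}" for j x
  proof (rule integrable_const_bound[where B = 1])
    note [measurable] = rank_meas[OF that]
    show "(\<lambda>\<omega>. of_bool (rank_le j \<omega> \<le> x) :: real) \<in> borel_measurable M" by measurable
  qed auto
  have int_p: "integrable M (\<lambda>\<omega>. indicator {..e} (pval X lam n \<omega>) :: real)" for e
    by (intro integrable_const_bound[where B = 1]) auto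
  have int_avg_lt: "integrable M (\<lambda>\<omega>. (\<Sum>j=s+1..n. of_bool (rank_lt j \<omega> \<le> x)) / real (n - s))" for x
    by (intro integrable_divide Bochner_Integration.integrable_sum int_lt) auto
  have int_avg_le: "integrable M (\<lambda>\<omega>. (\<Sum>j=s+1..n. of_bool (rank_le j \<omega> \<le> x)) / real (n - s))" for x
    by (intro integrable_divide Bochner_Integration.integrable_sum int_le) auto
  have cond_affine: "AE \<omega> in M. real_cond_exp M G (\<lambda>\<omega>. a + b * W \<omega>) \<omega> = a + b * Z \<omega>" for a b
  proof -
    have "AE \<omega> in M. real_cond_exp M G (\<lambda>\<omega>. a + b * W \<omega>) \<omega> =
        real_cond_exp M G (\<lambda>\<omega>. a) \<omega> + real_cond_exp M G (\<lambda>\<omega>. b * W \<omega>) \<omega>"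
      using W(1) by (intro real_cond_exp_add) auto
    moreover have "AE \<omega> in M. real_cond_exp M G (\<lambda>\<omega>. a) \<omega> = a"
      by (rule real_cond_exp_F_meas) auto
    moreover have "AE \<omega> in M. real_cond_exp M G (\<lambda>\<omega>. b * W \<omega>) \<omega> = b * Z \<omega>"
      unfolding Z_def using W(1) by (rule real_cond_exp_cmult)
    ultimately show ?thesis by eventually_elim simp
  qed
  have upper: "AE \<omega> in M. Fn \<omega> e \<le> HQ e + Z \<omega> / sqrt n" for e
  proof -
    have "AE \<omega> in M. measure (K \<omega>) {..e} = real_cond_exp M G (\<lambda>\<omega>. indicator {..e} (pval X lam n \<omega>)) \<omega>"
      by (rule K_cond) auto
    moreover have "AE \<omega> in M. real_cond_exp M G (\<lambda>\<omega>. indicator {..e} (pval X lam n \<omega>)) \<omega> \<le>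
        real_cond_exp M G (\<lambda>\<omega>. of_bool (rank_lt n \<omega> \<le> real n * e)) \<omega>"
    proof (rule real_cond_exp_mono[OF _ int_p int_lt[OF nn]])
      show "AE \<omega> in M. indicator {..e} (pval X lam n \<omega>) \<le> (of_bool (rank_lt n \<omega> \<le> real n * e) :: real)"
        using lam01 by eventually_elim (rule indicator_pval_bounds; simp)
    qed
    moreover have "AE \<omega> in M. real_cond_exp M G (\<lambda>\<omega>. of_bool (rank_lt n \<omega> \<le> real n * e)) \<omega> =
        real_cond_exp M G (\<lambda>\<omega>. (\<Sum>j=s+1..n. of_bool (rank_lt j \<omega> \<le> real n * e)) / real (n - s)) \<omega>"
      unfolding rank_lt_def by (rule cond_exp_rank_eq_average) measurable
    moreover have "AE \<omega> in M. real_cond_exp M G (\<lambda>\<omega>. (\<Sum>j=s+1..n. of_bool (rank_lt j \<omega> \<le> real n * e)) / real (n - s)) \<omega>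
        \<le> real_cond_exp M G (\<lambda>\<omega>. HQ e + (1 / sqrt n) * W \<omega>) \<omega>"
      by (rule real_cond_exp_mono[OF _ int_avg_lt]) (use W(1) W_upper in auto)
    moreover note cond_affine[of "HQ e" "1 / sqrt n"] AE_space
    ultimately show ?thesis
      by eventually_elim (simp add: Fn cdf_def)
  qed
  have lower: "AE \<omega> in M. HQ e - Z \<omega> / sqrt n \<le> Fn \<omega> e" for e
  proof -
    have "AE \<omega> in M. measure (K \<omega>) {..e} = real_cond_exp M G (\<lambda>\<omega>. indicator {..e} (pval X lam n \<omega>)) \<omega>"
      by (rule K_cond) auto
    moreover have "AE \<omega> in M. real_cond_exp M G (\<lambda>\<omega>. of_bool (rank_le n \<omega> \<le> real n * e)) \<omega> \<le>
        real_cond_exp M G (\<lambda>\<omega>. indicator {..e} (pval X lam n \<omega>)) \<omega>"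
    proof (rule real_cond_exp_mono[OF _ int_le[OF nn] int_p])
      show "AE \<omega> in M. of_bool (rank_le n \<omega> \<le> real n * e) \<le> (indicator {..e} (pval X lam n \<omega>) :: real)"
        using lam01 by eventually_elim (rule indicator_pval_bounds; simp)
    qed
    moreover have "AE \<omega> in M. real_cond_exp M G (\<lambda>\<omega>. of_bool (rank_le n \<omega> \<le> real n * e)) \<omega> =
        real_cond_exp M G (\<lambda>\<omega>. (\<Sum>j=s+1..n. of_bool (rank_le j \<omega> \<le> real n * e)) / real (n - s)) \<omega>"
      unfolding rank_le_def by (rule cond_exp_rank_eq_average) measurable
    moreover have "AE \<omega> in M. real_cond_exp M G (\<lambda>\<omega>. HQ e + (- 1 / sqrt n) * W \<omega>) \<omega> \<le>
        real_cond_exp M G (\<lambda>\<omega>. (\<Sum>j=s+1..n. of_bool (rank_le j \<omega> \<le> real n * e)) / real (n - s)) \<omega>"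
      by (rule real_cond_exp_mono[OF _ _ int_avg_le]) (use W(1) W_lower in auto)
    moreover note cond_affine[of "HQ e" "- 1 / sqrt n"] AE_space
    ultimately show ?thesis
      by eventually_elim (simp add: Fn cdf_def)
  qed
  \<comment> \<open>The exceptional null sets depend on \<open>e\<close>. They are merged over the
    rationals; monotonicity of \<open>Fn\<close> and the Lipschitz bound for \<open>HQ\<close> then
    reach every real \<open>e\<close>, a displacement below \<open>d / L\<close> costing at most
    \<open>d\<close>.\<close>
  have "AE \<omega> in M. \<forall>e\<in>\<rat>. \<bar>Fn \<omega> e - HQ e\<bar> \<le> Z \<omega> / sqrt n"
  proof (subst AE_ball_countable[OF countable_rat], intro ballI)
    fix e
    show "AE \<omega> in M. \<bar>Fn \<omega> e - HQ e\<bar> \<le> Z \<omega> / sqrt n"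
      using upper[of e] lower[of e] by eventually_elim linarith
  qed
  with AE_space have "AE \<omega> in M. \<forall>e. \<bar>Fn \<omega> e - HQ e\<bar> \<le> Z \<omega> / sqrt n"
  proof eventually_elim
    case (elim \<omega>)
    have "K \<omega> \<in> space (prob_algebra borel)"
      using measurable_space[OF K, of \<omega>] elim(1) by simp
    then interpret K: real_distribution "K \<omega>"
      by (auto simp: space_prob_algebra real_distribution_def real_distribution_axioms_def)
    have mono: "Fn \<omega> x \<le> Fn \<omega> y" if "x \<le> y" for x y
      using elim(1) that K.cdf_nondecreasing by (simp add: Fn)
    have L0: "0 < L" using L_ge(3) by simp
    show ?case
    proof
      fix e
      have "Fn \<omega> e \<le> HQ e + Z \<omega> / sqrt n"
      proof (rule field_le_epsilon)
        fix d :: real assume "0 < d"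
        then have "e < e + d / L" using L0 by simp
        then obtain \<rho> where \<rho>: "\<rho> \<in> \<rat>" "e < \<rho>" "\<rho> < e + d / L" using Rats_dense_in_real by blast
        then have "L * (\<rho> - e) \<le> d" using L0 by (simp add: field_simps)
        then show "Fn \<omega> e \<le> HQ e + Z \<omega> / sqrt n + d"
          using elim(2)[rule_format, OF \<rho>(1)] mono[of e \<rho>] HQ_Lipschitz[of e \<rho>] \<rho>(2) by linarith
      qed
      moreover have "HQ e - Z \<omega> / sqrt n \<le> Fn \<omega> e"
      proof (rule field_le_epsilon)
        fix d :: real assume "0 < d"
        then have "e - d / L < e" using L0 by simp
        then obtain \<rho> where \<rho>: "\<rho> \<in> \<rat>" "e - d / L < \<rho>" "\<rho> < e" using Rats_dense_in_real by blast
        then have "L * (e - \<rho>) \<le> d" using L0 by (simp add: field_simps)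
        then show "HQ e - Z \<omega> / sqrt n \<le> Fn \<omega> e + d"
          using elim(2)[rule_format, OF \<rho>(1)] mono[of \<rho> e] HQ_Lipschitz[of \<rho> e] \<rho>(3) by linarith
      qed
      ultimately show "\<bar>Fn \<omega> e - HQ e\<bar> \<le> Z \<omega> / sqrt n" by linarith
    qed
  qed
  with Z_int Z_pos W(3) Z_exp show ?thesis by (intro exI[of _ Z]) simp
qed

end

section \<open>Measurability of the supremum and tightness from bounded means\<close>

lemma right_continuous_le_of_rat:
  fixes g :: "real \<Rightarrow> real"
  assumes "continuous (at_right x) g" and "\<And>y. y \<in> \<rat> \<Longrightarrow> g y \<le> a"
  shows "g x \<le> a"
proof (rule ccontr)
  assume "\<not> g x \<le> a"
  then have "eventually (\<lambda>y. a < g y) (at_right x)"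
    using assms(1) unfolding continuous_within by (intro order_tendstoD(1)) auto
  then obtain b where b: "x < b" "\<And>y. x < y \<Longrightarrow> y < b \<Longrightarrow> a < g y"
    unfolding eventually_at_right_field by auto
  then obtain y where "y \<in> \<rat>" "x < y" "y < b" using Rats_dense_in_real by blast
  with assms(2)[of y] b(2)[of y] show False by auto
qed

text \<open>Both functions are CDFs of probability kernels, so their difference is right continuous
  in \<open>e\<close> and bounded by 1. Comparing the supremum with a constant thus becomes a
  countable condition over the rationals.\<close>

lemma cond_cdf_diff:
  assumes "is_cond_cdf M G Y F" "subalgebra M G" "is_cond_cdf M G' Y' F'" "subalgebra M G'"
  shows "(\<lambda>\<omega>. SUP e. \<bar>F \<omega> e - F' \<omega> e\<bar>) \<in> borel_measurable M"
    and "\<omega> \<in> space M \<Longrightarrow> bdd_above (range (\<lambda>e. \<bar>F \<omega> e - F' \<omega> e\<bar>))"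
proof -
  obtain K where K: "K \<in> measurable G (prob_algebra borel)"
    and F: "\<And>\<omega> e. \<omega> \<in> space M \<Longrightarrow> F \<omega> e = cdf (K \<omega>) e"
    using assms(1) unfolding is_cond_cdf_def regular_cond_distr_def by blast
  obtain K' where K': "K' \<in> measurable G' (prob_algebra borel)"
    and F': "\<And>\<omega> e. \<omega> \<in> space M \<Longrightarrow> F' \<omega> e = cdf (K' \<omega>) e"
    using assms(3) unfolding is_cond_cdf_def regular_cond_distr_def by blast
  have KM[measurable]: "K \<in> measurable M (prob_algebra borel)" "K' \<in> measurable M (prob_algebra borel)"
    using measurable_from_subalg[OF assms(2) K] measurable_from_subalg[OF assms(4) K'] by auto
  have rd: "real_distribution (K \<omega>)" "real_distribution (K' \<omega>)" if "\<omega> \<in> space M" for \<omega>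
    using measurable_space[OF KM(1) that] measurable_space[OF KM(2) that]
    by (auto simp: space_prob_algebra real_distribution_def real_distribution_axioms_def)
  have le1: "\<bar>F \<omega> e - F' \<omega> e\<bar> \<le> 1" if "\<omega> \<in> space M" for \<omega> e
  proof -
    interpret K: real_distribution "K \<omega>" by (rule rd[OF that])
    interpret K': real_distribution "K' \<omega>" by (rule rd[OF that])
    show ?thesis
      using K.cdf_bounded_prob[of e] K'.cdf_bounded_prob[of e] K.cdf_nonneg[of e] K'.cdf_nonneg[of e]
      unfolding F[OF that] F'[OF that] by linarith
  qed
  show bdd: "bdd_above (range (\<lambda>e. \<bar>F \<omega> e - F' \<omega> e\<bar>))" if "\<omega> \<in> space M" for \<omega>
    by (rule bdd_aboveI2[of _ _ 1]) (rule le1[OF that])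
  have F_meas: "(\<lambda>\<omega>. F \<omega> e) \<in> borel_measurable M" for e
  proof -
    have "(\<lambda>\<omega>. measure (K \<omega>) {..e}) \<in> borel_measurable M" by measurable
    then show ?thesis using F by (simp add: cdf_def cong: measurable_cong)
  qed
  have F'_meas: "(\<lambda>\<omega>. F' \<omega> e) \<in> borel_measurable M" for e
  proof -
    have "(\<lambda>\<omega>. measure (K' \<omega>) {..e}) \<in> borel_measurable M" by measurable
    then show ?thesis using F' by (simp add: cdf_def cong: measurable_cong)
  qed
  note [measurable] = F_meas F'_meas
  show "(\<lambda>\<omega>. SUP e. \<bar>F \<omega> e - F' \<omega> e\<bar>) \<in> borel_measurable M"
  proof (rule borel_measurableI_le)
    fix a
    have "(SUP e. \<bar>F \<omega> e - F' \<omega> e\<bar>) \<le> a \<longleftrightarrow> (\<forall>e\<in>\<rat>. \<bar>F \<omega> e - F' \<omega> e\<bar> \<le> a)" if \<omega>: "\<omega> \<in> space M" for \<omega>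
    proof -
      interpret K: real_distribution "K \<omega>" by (rule rd[OF \<omega>])
      interpret K': real_distribution "K' \<omega>" by (rule rd[OF \<omega>])
      have "continuous (at_right e) (\<lambda>e. \<bar>F \<omega> e - F' \<omega> e\<bar>)" for e
        unfolding F[OF \<omega>] F'[OF \<omega>]
        by (intro continuous_intros K.cdf_is_right_cont K'.cdf_is_right_cont)
      then have "(\<forall>e. \<bar>F \<omega> e - F' \<omega> e\<bar> \<le> a) \<longleftrightarrow> (\<forall>e\<in>\<rat>. \<bar>F \<omega> e - F' \<omega> e\<bar> \<le> a)"
        using right_continuous_le_of_rat[of _ "\<lambda>e. \<bar>F \<omega> e - F' \<omega> e\<bar>" a] by blast
      then show ?thesis using cSUP_le_iff[OF _ bdd[OF \<omega>], of a] by simp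
    qed
    then have "{\<omega> \<in> space M. (SUP e. \<bar>F \<omega> e - F' \<omega> e\<bar>) \<le> a} =
        {\<omega> \<in> space M. \<forall>e\<in>\<rat>. \<bar>F \<omega> e - F' \<omega> e\<bar> \<le> a}" by auto
    also have "\<dots> \<in> sets M"
      using countable_rat by measurable
    finally show "{\<omega> \<in> space M. (SUP e. \<bar>F \<omega> e - F' \<omega> e\<bar>) \<le> a} \<in> sets M" .
  qed
qed

text \<open>Markov's inequality applied to the dominating variable. That variable may change with
  \<open>n\<close>; a common bound on the means makes one interval serve all
  \<open>n\<close>.\<close>

lemma (in prob_space) bigO_pI:
  fixes Z :: "nat \<Rightarrow> 'a \<Rightarrow> real"
  assumes meas: "\<And>n. (\<lambda>\<omega>. Z n \<omega> / a n) \<in> borel_measurable M"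
    and bound: "\<And>n. \<exists>Y. integrable M Y \<and> expectation Y \<le> C \<and> (AE \<omega> in M. \<bar>Z n \<omega> / a n\<bar> \<le> Y \<omega>)"
  shows "bigO_p M Z a"
  unfolding bigO_p_def tight_def
proof (intro conjI allI impI)
  show "real_distribution (distr M borel (\<lambda>\<omega>. Z n \<omega> / a n))" for n
    using meas by (rule real_distribution_distr)
  fix \<epsilon> :: real assume \<epsilon>: "0 < \<epsilon>"
  \<comment> \<open>Any positive \<open>b\<close> with \<open>C / b < \<epsilon>\<close> would do;
    the added 1 gives positivity and strictness together.\<close>
  define b where "b = (\<bar>C\<bar> + 1) / \<epsilon>"
  have b: "0 < b" using \<epsilon> by (simp add: b_def)
  have "C < \<epsilon> * b" using \<epsilon> by (simp add: b_def)
  then have Cb: "C / b < \<epsilon>" using b by (simp add: divide_less_eq)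
  show "\<exists>l u. l < u \<and> (\<forall>n. 1 - \<epsilon> < measure (distr M borel (\<lambda>\<omega>. Z n \<omega> / a n)) {l<..u})"
  proof (intro exI conjI allI)
    show "- b < b" using b by simp
    fix n
    obtain Y where Y: "integrable M Y" "expectation Y \<le> C" "AE \<omega> in M. \<bar>Z n \<omega> / a n\<bar> \<le> Y \<omega>"
      using bound by blast
    note [measurable] = meas[of n] borel_measurable_integrable[OF Y(1)]
    have "prob {\<omega> \<in> space M. b \<le> Y \<omega>} \<le> expectation Y / b"
    proof (rule integral_Markov_inequality_measure[OF Y(1) _ _ b])
      show "AE \<omega> in M. 0 \<le> Y \<omega>" using Y(3) by eventually_elim linarith
    qed measurable
    also have "\<dots> \<le> C / b" using Y(2) b by (intro divide_right_mono) auto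
    also have "\<dots> < \<epsilon>" by (rule Cb)
    finally have "1 - \<epsilon> < prob (space M - {\<omega> \<in> space M. b \<le> Y \<omega>})"
      by (subst prob_compl) auto
    also have "\<dots> \<le> prob ((\<lambda>\<omega>. Z n \<omega> / a n) -` {-b<..b} \<inter> space M)"
    proof (rule finite_measure_mono_AE)
      show "AE \<omega> in M. \<omega> \<in> space M - {\<omega> \<in> space M. b \<le> Y \<omega>} \<longrightarrow>
          \<omega> \<in> (\<lambda>\<omega>. Z n \<omega> / a n) -` {-b<..b} \<inter> space M"
        using Y(3)
      proof eventually_elim
        case (elim \<omega>)
        show ?case
        proof
          assume "\<omega> \<in> space M - {\<omega> \<in> space M. b \<le> Y \<omega>}"
          then have "\<omega> \<in> space M" "\<bar>Z n \<omega> / a n\<bar> < b" using elim by auto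
          then show "\<omega> \<in> (\<lambda>\<omega>. Z n \<omega> / a n) -` {-b<..b} \<inter> space M"
            by (simp add: abs_less_iff del: abs_divide)
        qed
      qed
    qed measurable
    also have "\<dots> = measure (distr M borel (\<lambda>\<omega>. Z n \<omega> / a n)) {-b<..b}"
      by (subst measure_distr) auto
    finally show "1 - \<epsilon> < measure (distr M borel (\<lambda>\<omega>. Z n \<omega> / a n)) {-b<..b}" .
  qed
qed

text \<open>A distribution function is continuous at \<open>x\<close> exactly when
  \<open>{x}\<close> has no mass, and singletons are Lebesgue null.\<close>

lemma isCont_cdf_density_lborel:
  assumes "real_distribution D" "D = density lborel f" "f \<in> borel_measurable borel"
  shows "isCont (cdf D) x"
proof -
  interpret real_distribution D by fact
  have "AE y in lborel. y \<in> {x} \<longrightarrow> f y = 0"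
    using AE_lborel_singleton[of x] by eventually_elim simp
  then have "{x} \<in> null_sets D"
    unfolding assms(2) using assms(3) by (subst null_sets_density_iff) auto
  then show ?thesis unfolding isCont_cdf by (simp add: null_sets_def measure_def)
qed

theorem theorem3:
  fixes M :: "'a measure"
    and R Q :: "real measure"
    and dQdR :: "real \<Rightarrow> ennreal"
    and r q :: "real \<Rightarrow> real"
    and c :: real
    and X :: "nat \<Rightarrow> nat \<Rightarrow> 'a \<Rightarrow> real"
    and lam :: "nat \<Rightarrow> 'a \<Rightarrow> real"
    and F :: "nat \<Rightarrow> 'a \<Rightarrow> real \<Rightarrow> real"
  assumes "prob_space M"
    and "real_distribution R" and "real_distribution Q"
    and "absolutely_continuous R Q"
    and "dQdR \<in> borel_measurable borel"
    and "AE x in R. dQdR x = RN_deriv R Q x"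
    and "\<And>x. dQdR x < \<infinity>"
    and "0 < c" and "c < 1"
    and "\<And>n. n \<ge> 1 \<Longrightarrow> iid M R (X n) {1..tau c n}"
    and "\<And>n. n \<ge> 1 \<Longrightarrow> iid M Q (X n) {tau c n + 1..n}"
    and "\<And>n. n \<ge> 1 \<Longrightarrow>
      prob_space.indep_var M
        (PiM {1..tau c n} (\<lambda>_. borel)) (\<lambda>\<omega>. \<lambda>j\<in>{1..tau c n}. X n j \<omega>)
        (PiM {tau c n + 1..n} (\<lambda>_. borel)) (\<lambda>\<omega>. \<lambda>j\<in>{tau c n + 1..n}. X n j \<omega>)"
    and "\<And>\<delta>. 0 < \<delta> \<Longrightarrow> \<delta> < 1 \<Longrightarrow> \<exists>!x. is_quantile (mixture c R Q) \<delta> x"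
    and "continuous_on UNIV r" and "\<And>x. 0 \<le> r x" and "R = density lborel (\<lambda>x. ennreal (r x))"
    and "continuous_on UNIV q" and "\<And>x. 0 \<le> q x" and "Q = density lborel (\<lambda>x. ennreal (q x))"
    and "(\<integral>\<^sup>+ z. (dQdR z)\<^sup>2 \<partial>Q) < \<infinity>"
    and "(\<integral>\<^sup>+ z. (dQdR z)\<^sup>2 \<partial>R) < \<infinity>"
    and "iid M (uniform_measure lborel {0<..<1}) lam {1..}"
    and "indep_pair M
        (PiM {1..} (\<lambda>_. borel)) (\<lambda>\<omega>. \<lambda>n\<in>{1..}. lam n \<omega>)
        (PiM (SIGMA n:{1..}. {1..n}) (\<lambda>_. borel))
          (\<lambda>\<omega>. \<lambda>i\<in>(SIGMA n:{1..}. {1..n}). X (fst i) (snd i) \<omega>)"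
    and "\<And>n. n \<ge> 1 \<Longrightarrow> is_cond_cdf M (row_algebra M X n) (pval X lam n) (F n)"
  shows "bigO_p M (\<lambda>n \<omega>. SUP \<epsilon>. \<bar>F n \<omega> \<epsilon> - F (n + 1) \<omega> \<epsilon>\<bar>) (\<lambda>n. 1 / sqrt (real n))"
proof -
  interpret prob_space M by fact
  interpret mix: mixture_cdf R Q c
  proof (rule mixture_cdf.intro)
    show "mixture_cdf_axioms R Q c"
    proof
      have "r \<in> borel_measurable borel" "q \<in> borel_measurable borel"
        using assms(14,17) by (auto intro: borel_measurable_continuous_onI)
      then show "isCont (cdf R) x" "isCont (cdf Q) x" for x
        using isCont_cdf_density_lborel[OF assms(2,16)] isCont_cdf_density_lborel[OF assms(3,19)] by auto
    qed (fact assms)+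
  qed (fact assms)+
  have row: "two_sample_mixture M R Q X (tau c n) n c" if n: "1 \<le> n" for n
  proof
    have "0 \<le> c * real n" using assms(8) by simp
    then have tau: "real (tau c n) = of_int \<lfloor>c * real n\<rfloor>" by (simp add: tau_def)
    show tau_le: "real (tau c n) \<le> c * real n" and "c * real n \<le> real (tau c n) + 1"
      unfolding tau by linarith+
    have "c * real n < 1 * real n" using assms(9) n by (intro mult_strict_right_mono) auto
    with tau_le show "tau c n < n" by simp
  qed (use assms n in auto)
  have lam_meas: "lam n \<in> borel_measurable M" if "1 \<le> n" for n
    using assms(22) that by (auto simp: iid_def indep_vars_def)
  \<comment> \<open>Only the law of \<open>lam n\<close> is given, so its range is known almost
    surely rather than everywhere.\<close>
  have lam01: "AE \<omega> in M. 0 \<le> lam n \<omega> \<and> lam n \<omega> \<le> 1" if n: "1 \<le> n" for n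
  proof -
    have "AE x in uniform_measure lborel {0<..<1::real}. 0 \<le> x \<and> x \<le> 1"
      by (rule AE_uniform_measureI) auto
    moreover have "distr M borel (lam n) = uniform_measure lborel {0<..<1}"
      using assms(22) n by (simp add: iid_def)
    ultimately have "AE x in distr M borel (lam n). 0 \<le> x \<and> x \<le> 1" by (simp only:)
    then show ?thesis by (rule AE_distrD[OF lam_meas[OF n]])
  qed
  define C where "C = mix.L * (81 * mix.L\<^sup>2 + 2)"
  have C0: "0 \<le> C" using mix.L_ge(3) by (simp add: C_def)
  have bound: "\<exists>Z. integrable M Z \<and> (AE \<omega> in M. 0 \<le> Z \<omega>) \<and> expectation Z \<le> C \<and>
      (AE \<omega> in M. \<forall>e. \<bar>F n \<omega> e - mix.HQ e\<bar> \<le> Z \<omega> / sqrt n)" if n: "1 \<le> n" for n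
  proof -
    interpret two_sample_mixture M R Q X "tau c n" n c by (rule row[OF n])
    show ?thesis
      unfolding C_def by (rule cond_cdf_bound[OF lam_meas[OF n] lam01[OF n] assms(24)[OF n]])
  qed
  have subalg: "subalgebra M (row_algebra M X n)" if n: "1 \<le> n" for n
  proof -
    interpret two_sample_mixture M R Q X "tau c n" n c by (rule row[OF n])
    show ?thesis by (rule subalgebra_G)
  qed
  note diff = cond_cdf_diff[OF assms(24) subalg assms(24) subalg]
  show ?thesis
  proof (rule bigO_pI)
    fix n
    let ?D = "\<lambda>\<omega>. SUP \<epsilon>. \<bar>F n \<omega> \<epsilon> - F (n + 1) \<omega> \<epsilon>\<bar>"
    show "(\<lambda>\<omega>. ?D \<omega> / (1 / sqrt (real n))) \<in> borel_measurable M"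
      using diff(1)[of n "n + 1"] by (cases "n = 0") auto
    show "\<exists>Y. integrable M Y \<and> expectation Y \<le> 2 * C \<and> (AE \<omega> in M. \<bar>?D \<omega> / (1 / sqrt (real n))\<bar> \<le> Y \<omega>)"
    proof (cases "n = 0")
      \<comment> \<open>For \<open>n = 0\<close> the quotient is 0 by the convention on division by
        zero.\<close>
      case True
      then show ?thesis using C0 by (intro exI[of _ "\<lambda>_. 0"]) auto
    next
      case False
      then have n: "1 \<le> n" "1 \<le> n + 1" by auto
      obtain Z where Z: "integrable M Z" "AE \<omega> in M. 0 \<le> Z \<omega>" "expectation Z \<le> C"
        "AE \<omega> in M. \<forall>e. \<bar>F n \<omega> e - mix.HQ e\<bar> \<le> Z \<omega> / sqrt n"
        using bound[OF n(1)] by blast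
      obtain Z' where Z': "integrable M Z'" "AE \<omega> in M. 0 \<le> Z' \<omega>" "expectation Z' \<le> C"
        "AE \<omega> in M. \<forall>e. \<bar>F (n + 1) \<omega> e - mix.HQ e\<bar> \<le> Z' \<omega> / sqrt (n + 1)"
        using bound[OF n(2)] by blast
      \<comment> \<open>Triangle inequality through the function \<open>HQ\<close>, which is the
        same for both rows. It takes place pointwise, so no joint law of the two rows
        enters.\<close>
      have "AE \<omega> in M. \<bar>?D \<omega> / (1 / sqrt (real n))\<bar> \<le> Z \<omega> + Z' \<omega>"
        using Z(4) Z'(2,4) AE_space
      proof eventually_elim
        case (elim \<omega>)
        have "Z' \<omega> / sqrt (n + 1) \<le> Z' \<omega> / sqrt n"
          using elim(2) n by (intro divide_left_mono) auto
        then have "\<bar>F n \<omega> e - F (n + 1) \<omega> e\<bar> \<le> (Z \<omega> + Z' \<omega>) / sqrt n" for e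
          using elim(1)[rule_format, of e] elim(3)[rule_format, of e] by (simp add: add_divide_distrib)
        then have "?D \<omega> \<le> (Z \<omega> + Z' \<omega>) / sqrt n" by (intro cSUP_least) auto
        \<comment> \<open>The supremum dominates its nonnegative member at 0; boundedness above is
          what makes \<open>SUP\<close> on the reals an upper bound.\<close>
        moreover have "0 \<le> ?D \<omega>"
          using cSUP_upper[OF UNIV_I diff(2)[OF n(1) n(1) n(2) n(2) elim(4)], of 0] by (intro order_trans[OF abs_ge_zero])
        ultimately show ?case using n by (simp add: abs_mult field_simps)
      qed
      then show ?thesis
        using Z(1,3) Z'(1,3) by (intro exI[of _ "\<lambda>\<omega>. Z \<omega> + Z' \<omega>"]) auto
    qed
  qed
qed

end
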